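(* Let $q\in(0,1)$ and $\kappa\in\mathbf i\mathbb R_{>0}$ be fixed, and let the parameters $T,S,N,t$ grow proportionally to $L\to+\infty$: $T=\lfloor L\mathsf T\rfloor$, $S=\lfloor L\mathsf S\rfloor$, $N=\lfloor L\mathsf N\rfloor$, $t=\lfloor L\mathsf t\rfloor$, where $\mathsf T>\mathsf S>0$, $\mathsf N>0$. Fix the scaled values $\mathsf T,\mathsf S,\mathsf N,\mathsf t$. For any $\varepsilon>0$, there exists $c>0$ (depending on $\mathsf T,\mathsf S,\mathsf N,\mathsf t,\varepsilon$) such that, under the $q$-Racah measure with parameters $(T,S,N)$, $$\mathbb P\Bigl(\text{there exists a hole in the nonintersecting path ensemble at some point }(t,y),\text{ where }\mathsf t_l+\varepsilon<\tfrac tL<\mathsf t_r-\varepsilon\text{ and }\Bigl|\tfrac yL-\tfrac{\mathsf S+\mathsf t}{2}\Bigr|<\tfrac{\mathsf N-\varepsilon}{2}\Bigr)<e^{-cL}$$ for all $L$ large enough. Here $\mathsf t_l=|\mathsf N-\mathsf S|$ and $\mathsf t_r=\min(\mathsf N+\mathsf S,\,2\mathsf T-\mathsf N-\mathsf S)$.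
   Context: For integers $T>S>0$, $N\ge1$, consider ensembles of $N$ nonintersecting lattice paths with steps $(t,x)\to(t+1,x)$ or $(t,x)\to(t+1,x+1)$, starting at $(0,0),\dots,(0,N-1)$ and ending at $(T,S),\dots,(T,S+N-1)$. Let $X(t)=(x_1(t)<\dots<x_N(t))$ be the path positions at time $t$; they lie in $I_t=\{x\in\mathbb Z:\max(0,t+S-T)\le x\le\min(t+N-1,S+N-1)\}$. A hole is a point $(t,x)$ with $0\le t\le T$, $x\in I_t\setminus X(t)$ (it corresponds to a horizontal lozenge of the associated lozenge tiling of the hexagon). The $q$-Racah measure assigns to each path ensemble probability proportional to $$\prod_{\text{holes }(t,x)}\mathsf w(x-\tfrac t2+1),\qquad \mathsf w(j)=\kappa q^{j-(S+1)/2}-\frac1{\kappa q^{j-(S+1)/2}};$$ all factors are purely imaginary with imaginary parts of the same sign, and the number of holes is $S(T-S)$ for every ensemble, so this is a probability measure after normalization. *)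

theory Defs
  imports "HOL-Probability.Probability"
begin

text \<open>
  Times, positions and labels are integers. An ensemble is a function \<open>X\<close> with \<open>X t i = x\<^sub>i(t)\<close> for
  \<open>0 \<le> t \<le> T\<close> and \<open>1 \<le> i \<le> N\<close>, and \<open>undefined\<close> elsewhere, so that each ensemble is counted once.
  The paths are labelled from the bottom up; since they have no common vertex and each steps by 0 or 1,
  this order is the same at all times.
\<close>

definition path_ensembles :: "int \<Rightarrow> int \<Rightarrow> int \<Rightarrow> (int \<Rightarrow> int \<Rightarrow> int) set" where
  "path_ensembles T S N =
    {X \<in> {0..T} \<rightarrow>\<^sub>E ({1..N} \<rightarrow>\<^sub>E UNIV).
       (\<forall>i\<in>{1..N}. X 0 i = i - 1 \<and> X T i = S + i - 1) \<and>
       (\<forall>i\<in>{1..N}. \<forall>t\<in>{0..<T}. X (t + 1) i = X t i \<or> X (t + 1) i = X t i + 1) \<and>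
       (\<forall>t\<in>{0..T}. strict_mono_on {1..N} (X t))}"

definition level_range :: "int \<Rightarrow> int \<Rightarrow> int \<Rightarrow> int \<Rightarrow> int set" where
  "level_range T S N t = {max 0 (t + S - T)..min (t + N - 1) (S + N - 1)}"

definition holes :: "int \<Rightarrow> int \<Rightarrow> int \<Rightarrow> (int \<Rightarrow> int \<Rightarrow> int) \<Rightarrow> (int \<times> int) set" where
  "holes T S N X = (SIGMA t:{0..T}. level_range T S N t - X t ` {1..N})"

definition qRacah_w :: "real \<Rightarrow> complex \<Rightarrow> int \<Rightarrow> real \<Rightarrow> complex" where
  "qRacah_w q \<kappa> S j =
     (let u = \<kappa> * complex_of_real (q powr (j - (real_of_int S + 1) / 2)) in u - 1 / u)"

definition ensemble_weight ::
    "real \<Rightarrow> complex \<Rightarrow> int \<Rightarrow> int \<Rightarrow> int \<Rightarrow> (int \<Rightarrow> int \<Rightarrow> int) \<Rightarrow> complex" where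
  "ensemble_weight q \<kappa> T S N X =
     (\<Prod>(t, x)\<in>holes T S N X. qRacah_w q \<kappa> S (real_of_int x - real_of_int t / 2 + 1))"

definition partition_function :: "real \<Rightarrow> complex \<Rightarrow> int \<Rightarrow> int \<Rightarrow> int \<Rightarrow> complex" where
  "partition_function q \<kappa> T S N = (\<Sum>X\<in>path_ensembles T S N. ensemble_weight q \<kappa> T S N X)"

text \<open>
  The quotient below is a nonnegative real number for \<open>\<kappa> \<in> \<i>\<real>\<^sub>>\<^sub>0\<close>, so \<open>Re\<close> only changes its type; see
  \<open>weight_quotient_real\<close> and \<open>prob_space_qRacah_measure\<close>.
\<close>

definition qRacah_measure ::
    "real \<Rightarrow> complex \<Rightarrow> int \<Rightarrow> int \<Rightarrow> int \<Rightarrow> (int \<Rightarrow> int \<Rightarrow> int) measure" where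
  "qRacah_measure q \<kappa> T S N =
     point_measure (path_ensembles T S N)
       (\<lambda>X. ennreal (Re (ensemble_weight q \<kappa> T S N X / partition_function q \<kappa> T S N)))"

lemma ensemble_in_level_range:
  assumes X: "X \<in> path_ensembles T S N" and i: "i \<in> {1..N}" and t: "t \<in> {0..T}"
  shows "X t i \<in> level_range T S N t"
proof -
  have st: "X (s + 1) i = X s i \<or> X (s + 1) i = X s i + 1" if "0 \<le> s" "s < T" for s
    using X i that unfolding path_ensembles_def by auto
  have b0: "X 0 i = i - 1" and bT: "X T i = S + i - 1"
    using X i unfolding path_ensembles_def by auto
  have "s \<le> T \<longrightarrow> i - 1 \<le> X s i \<and> X s i \<le> i - 1 + s" if "0 \<le> s" for s
    using that
  proof (induction s rule: int_ge_induct)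
    case (step s)
    then show ?case using st[of s] by auto
  qed (use b0 in auto)
  then have f: "i - 1 \<le> X t i \<and> X t i \<le> i - 1 + t" using t by auto
  have "0 \<le> s \<longrightarrow> X s i \<le> S + i - 1 \<and> S + i - 1 \<le> X s i + (T - s)" if "s \<le> T" for s
    using that
  proof (induction s rule: int_le_induct)
    case (step s)
    then show ?case using st[of "s - 1"] by auto
  qed (use bT in auto)
  then have g: "X t i \<le> S + i - 1 \<and> S + i - 1 \<le> X t i + (T - t)" using t by auto
  show ?thesis using f g i unfolding level_range_def by auto
qed

lemma finite_path_ensembles: "finite (path_ensembles T S N)"
proof (rule finite_subset)
  show "path_ensembles T S N \<subseteq> {0..T} \<rightarrow>\<^sub>E ({1..N} \<rightarrow>\<^sub>E {0..S + N - 1})"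
  proof
    fix X assume X: "X \<in> path_ensembles T S N"
    have "X \<in> {0..T} \<rightarrow>\<^sub>E ({1..N} \<rightarrow>\<^sub>E UNIV)" using X unfolding path_ensembles_def by blast
    moreover have "X t i \<in> {0..S + N - 1}" if "t \<in> {0..T}" "i \<in> {1..N}" for t i
      using ensemble_in_level_range[OF X that(2,1)] unfolding level_range_def by auto
    ultimately show "X \<in> {0..T} \<rightarrow>\<^sub>E ({1..N} \<rightarrow>\<^sub>E {0..S + N - 1})"
      unfolding PiE_iff by blast
  qed
  show "finite ({0..T} \<rightarrow>\<^sub>E ({1..N} \<rightarrow>\<^sub>E {0..S + N - 1}))"
    by (intro finite_PiE) auto
qed

lemma path_ensembles_nonempty:
  assumes "0 < S" "S < T"
  shows "path_ensembles T S N \<noteq> {}"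
proof -
  have "(\<lambda>t\<in>{0..T}. \<lambda>i\<in>{1..N}. i - 1 + min t S) \<in> path_ensembles T S N"
    using assms unfolding path_ensembles_def by (auto simp: strict_mono_on_def)
  then show ?thesis by blast
qed

lemma card_level_holes:
  assumes X: "X \<in> path_ensembles T S N" and t: "t \<in> {0..T}"
  shows "card (level_range T S N t - X t ` {1..N}) = card (level_range T S N t) - nat N"
proof -
  have "strict_mono_on {1..N} (X t)" using X t unfolding path_ensembles_def by auto
  then have "card (X t ` {1..N}) = nat N"
    by (simp add: card_image strict_mono_on_imp_inj_on)
  moreover have "X t ` {1..N} \<subseteq> level_range T S N t"
    using ensemble_in_level_range[OF X _ t] by auto
  ultimately show ?thesis by (simp add: card_Diff_subset)
qed

lemma card_holes:
  assumes "X \<in> path_ensembles T S N"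
  shows "card (holes T S N X) = (\<Sum>t\<in>{0..T}. card (level_range T S N t) - nat N)"
proof -
  have "finite (level_range T S N t - X t ` {1..N})" for t
    by (simp add: level_range_def)
  then have "card (holes T S N X) = (\<Sum>t\<in>{0..T}. card (level_range T S N t - X t ` {1..N}))"
    unfolding holes_def by (intro card_SigmaI) auto
  also have "\<dots> = (\<Sum>t\<in>{0..T}. card (level_range T S N t) - nat N)"
    by (rule sum.cong[OF refl]) (rule card_level_holes[OF assms])
  finally show ?thesis .
qed

lemma qRacah_w_imaginary:
  assumes "0 < q" "Re \<kappa> = 0" "0 < Im \<kappa>"
  obtains b where "0 < b" "qRacah_w q \<kappa> S j = \<i> * complex_of_real b"
proof -
  define a where "a = Im \<kappa> * q powr (j - (real_of_int S + 1) / 2)"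
  have a: "a > 0" using assms by (simp add: a_def)
  have k: "\<kappa> = \<i> * complex_of_real (Im \<kappa>)" using assms by (simp add: complex_eq_iff)
  have "\<kappa> * complex_of_real (q powr (j - (real_of_int S + 1) / 2)) = \<i> * complex_of_real a"
    by (subst k) (simp add: a_def)
  then have "qRacah_w q \<kappa> S j = \<i> * complex_of_real (a + 1 / a)"
    using a by (simp add: qRacah_w_def Let_def field_simps)
  then show ?thesis using that[of "a + 1 / a"] a by (simp add: add_pos_pos)
qed

lemma ensemble_weight_phase:
  assumes "0 < q" "Re \<kappa> = 0" "0 < Im \<kappa>"
  shows "\<exists>r>0. ensemble_weight q \<kappa> T S N X = \<i> ^ card (holes T S N X) * complex_of_real r"
proof -
  have "\<forall>p. \<exists>b>0. qRacah_w q \<kappa> S (real_of_int (snd p) - real_of_int (fst p) / 2 + 1) =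
      \<i> * complex_of_real b"
    using qRacah_w_imaginary[OF assms] by metis
  then obtain b where b: "\<And>p. 0 < b p"
    "\<And>p. qRacah_w q \<kappa> S (real_of_int (snd p) - real_of_int (fst p) / 2 + 1) =
      \<i> * complex_of_real (b p)" by metis
  have "ensemble_weight q \<kappa> T S N X =
      \<i> ^ card (holes T S N X) * complex_of_real (\<Prod>p\<in>holes T S N X. b p)"
    unfolding ensemble_weight_def case_prod_beta b(2) by (simp add: prod.distrib)
  moreover have "0 < (\<Prod>p\<in>holes T S N X. b p)" using b(1) by (simp add: prod_pos)
  ultimately show ?thesis by blast
qed

lemma weight_quotient_real:
  assumes q: "0 < q" "Re \<kappa> = 0" "0 < Im \<kappa>" and "0 < S" "S < T"
  shows "partition_function q \<kappa> T S N \<noteq> 0"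
    and "X \<in> path_ensembles T S N \<Longrightarrow>
      \<exists>p>0. ensemble_weight q \<kappa> T S N X / partition_function q \<kappa> T S N = complex_of_real p"
proof -
  define K where "K = (\<Sum>t\<in>{0..T}. card (level_range T S N t) - nat N)"
  have "\<forall>X\<in>path_ensembles T S N.
      \<exists>r>0. ensemble_weight q \<kappa> T S N X = \<i> ^ K * complex_of_real r"
    using ensemble_weight_phase[OF q] card_holes unfolding K_def by metis
  then obtain r where r: "\<And>X. X \<in> path_ensembles T S N \<Longrightarrow> 0 < r X"
    "\<And>X. X \<in> path_ensembles T S N \<Longrightarrow> ensemble_weight q \<kappa> T S N X = \<i> ^ K * complex_of_real (r X)"
    by metis
  define R where "R = (\<Sum>X\<in>path_ensembles T S N. r X)"
  have R: "R > 0" unfolding R_def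
    using finite_path_ensembles path_ensembles_nonempty[of S T N] assms r(1) by (intro sum_pos) auto
  have Z: "partition_function q \<kappa> T S N = \<i> ^ K * complex_of_real R"
    unfolding partition_function_def R_def using r(2) by (simp add: sum_distrib_left)
  then show "partition_function q \<kappa> T S N \<noteq> 0" using R by simp
  assume X: "X \<in> path_ensembles T S N"
  have "ensemble_weight q \<kappa> T S N X / partition_function q \<kappa> T S N = complex_of_real (r X / R)"
    using R by (simp add: Z r(2)[OF X])
  moreover have "0 < r X / R" using r(1)[OF X] R by simp
  ultimately show "\<exists>p>0. ensemble_weight q \<kappa> T S N X / partition_function q \<kappa> T S N = complex_of_real p"
    by blast
qed

lemma prob_space_qRacah_measure:
  assumes "0 < q" "Re \<kappa> = 0" "0 < Im \<kappa>" "0 < S" "S < T"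
  shows "prob_space (qRacah_measure q \<kappa> T S N)"
proof (rule prob_spaceI)
  let ?P = "path_ensembles T S N"
  let ?f = "\<lambda>X. ensemble_weight q \<kappa> T S N X / partition_function q \<kappa> T S N"
  have nn: "0 \<le> Re (?f X)" if "X \<in> ?P" for X
    using weight_quotient_real(2)[OF assms that] by auto
  have "(\<Sum>X\<in>?P. ?f X) = 1"
    using weight_quotient_real(1)[OF assms]
    by (simp add: partition_function_def flip: sum_divide_distrib)
  then have "(\<Sum>X\<in>?P. Re (?f X)) = 1" by (metis Re_sum one_complex.simps(1))
  moreover have "emeasure (qRacah_measure q \<kappa> T S N) ?P = (\<Sum>X\<in>?P. ennreal (Re (?f X)))"
    unfolding qRacah_measure_def by (rule emeasure_point_measure_finite[OF finite_path_ensembles order_refl])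
  ultimately show "emeasure (qRacah_measure q \<kappa> T S N) (space (qRacah_measure q \<kappa> T S N)) = 1"
    using nn by (simp add: sum_ennreal qRacah_measure_def space_point_measure)
qed

end

theory Submission
  imports Defs "HOL-Real_Asymp.Real_Asymp"
begin

text \<open>
  The holes of an ensemble form a plane partition in an \<open>S \<times> (T - S)\<close> box with entries in \<open>{0..N}\<close>,
  and the measure has the product weight \<open>\<Prod> 2 cosh (\<theta> (v\<^sub>s - m\<^sub>s))\<close> with \<open>\<theta> = ln (1/q)\<close> and \<open>m\<^sub>s\<close> linear
  in the cell \<open>s\<close>. The weight increases away from \<open>m\<^sub>s\<close>, so entries prefer \<open>0\<close> or \<open>N\<close>, whichever is
  farther from \<open>m\<^sub>s\<close>. A hole in the central band is an entry at some cell \<open>s\<close> at distance of order \<open>L\<close>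
  from its preferred value \<open>e\<close>. All cells of the rectangle from \<open>s\<close> to a corner of the box (the corner
  with the same preferred value) deviate less from \<open>e\<close> than \<open>s\<close> does. Resetting this rectangle to \<open>e\<close> gives
  an admissible ensemble and multiplies the weight by at least \<open>\<rho>\<^sup>-\<^sup>|\<^sup>p\<^sup>|\<close>, where \<open>p\<close> is the plane partition of deviations and \<open>\<rho> < 1\<close>
  does not depend on \<open>L\<close>. Since \<open>\<Sum>\<^sub>p \<rho>\<^sup>|\<^sup>p\<^sup>|\<close> over all plane partitions is finite and the corner entry of
  \<open>p\<close> is of order \<open>L\<close>, a Peierls estimate gives the exponential bound.
\<close>

subsection \<open>Generating functions of plane partitions\<close>

lemma geometric_sum_le:
  fixes x :: real
  assumes "0 \<le> x" "x < 1"
  shows "(\<Sum>j\<le>n. x ^ j) \<le> 1 / (1 - x)"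
proof -
  have "(1 - x) * (\<Sum>j\<le>n. x ^ j) = 1 - x ^ Suc n" by (rule sum_gp_basic)
  moreover have "0 \<le> x ^ Suc n" using assms by (intro zero_le_power)
  ultimately have "(\<Sum>j\<le>n. x ^ j) * (1 - x) \<le> 1" by (simp only: mult.commute[of _ "1 - x"])
  then show ?thesis using assms by (subst pos_le_divide_eq) simp_all
qed

text \<open>
  A function is determined by the multiplicities of its level sets, which gives the Euler product
  \<open>\<Prod> 1 / (1 - \<rho>\<^sup>|\<^sup>A\<^sup>|)\<close> as an upper bound. The level sets of a plane partition are Young
  diagrams, that is, again partitions, so the bound can be iterated.
\<close>

lemma sum_level_sets_le:
  fixes \<rho> :: real and F :: "('a \<Rightarrow> nat) set"
  assumes U: "finite U" and Fam: "finite \<A>" "\<And>A. A \<in> \<A> \<Longrightarrow> A \<subseteq> U \<and> A \<noteq> {}"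
    and F: "F \<subseteq> U \<rightarrow>\<^sub>E {..K}"
    and lev: "\<And>p h. p \<in> F \<Longrightarrow> {s \<in> U. h < p s} \<noteq> {} \<Longrightarrow> {s \<in> U. h < p s} \<in> \<A>"
    and \<rho>: "0 < \<rho>" "\<rho> < 1"
  shows "(\<Sum>p\<in>F. \<rho> ^ (\<Sum>s\<in>U. p s)) \<le> exp ((\<Sum>A\<in>\<A>. \<rho> ^ card A) / (1 - \<rho>))"
proof -
  \<comment> \<open>For \<open>p \<in> F\<close>, \<open>mul p A\<close> counts the heights with
    level set \<open>A\<close>; heights from \<open>K\<close> on have an empty level set. Each
    height below \<open>p s\<close> gives one level set through \<open>s\<close>, so the
    multiplicities determine \<open>p\<close>.\<close>
  define mul where "mul p = (\<lambda>A\<in>\<A>. card {h\<in>{..<K}. {s \<in> U. h < p s} = A})" for p :: "'a \<Rightarrow> nat"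
  have val: "p s = (\<Sum>A\<in>{A\<in>\<A>. s \<in> A}. mul p A)" if "p \<in> F" "s \<in> U" for p s
  proof -
    have ps: "p s \<le> K" using that F by auto
    have "{h. h < p s} = (\<Union>A\<in>{A\<in>\<A>. s \<in> A}. {h\<in>{..<K}. {s \<in> U. h < p s} = A})"
    proof (intro set_eqI iffI)
      fix h assume "h \<in> {h. h < p s}"
      then have h: "h < p s" by simp
      have "s \<in> {s \<in> U. h < p s}" using h that by simp
      then show "h \<in> (\<Union>A\<in>{A\<in>\<A>. s \<in> A}. {h\<in>{..<K}. {s \<in> U. h < p s} = A})"
        using lev[OF that(1), of h] h ps by (intro UN_I[of "{s \<in> U. h < p s}"]) auto
    qed (use that in auto)
    then have "card {h. h < p s} = (\<Sum>A\<in>{A\<in>\<A>. s \<in> A}. card {h\<in>{..<K}. {s \<in> U. h < p s} = A})"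
      using Fam(1) by (simp only:) (rule card_UN_disjoint, auto)
    then show ?thesis by (simp add: mul_def)
  qed
  have tot: "(\<Sum>s\<in>U. p s) = (\<Sum>A\<in>\<A>. mul p A * card A)" if "p \<in> F" for p
  proof -
    have "(\<Sum>s\<in>U. p s) = (\<Sum>s\<in>U. \<Sum>A\<in>\<A>. if s \<in> A then mul p A else 0)"
      using val[OF that] Fam(1) by (intro sum.cong) (auto simp: sum.inter_filter)
    also have "\<dots> = (\<Sum>A\<in>\<A>. \<Sum>s\<in>U. if s \<in> A then mul p A else 0)" by (rule sum.swap)
    also have "\<dots> = (\<Sum>A\<in>\<A>. mul p A * card A)"
    proof (rule sum.cong[OF refl])
      fix A assume "A \<in> \<A>"
      then have "U \<inter> A = A" using Fam(2) by blast
      then show "(\<Sum>s\<in>U. if s \<in> A then mul p A else 0) = mul p A * card A"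
        using U by (simp add: sum.If_cases Int_def[symmetric])
    qed
    finally show ?thesis .
  qed
  have inj: "inj_on mul F"
  proof (rule inj_onI)
    fix p p' assume p: "p \<in> F" "p' \<in> F" "mul p = mul p'"
    have "p s = p' s" if "s \<in> U" for s using val[OF p(1) that] val[OF p(2) that] p(3) by simp
    moreover have "p \<in> U \<rightarrow>\<^sub>E {..K}" "p' \<in> U \<rightarrow>\<^sub>E {..K}" using p F by auto
    ultimately show "p = p'" by (rule_tac PiE_ext) auto
  qed
  have mulE: "mul p \<in> \<A> \<rightarrow>\<^sub>E {..K}" for p
  proof -
    have "card {h\<in>{..<K}. {s \<in> U. h < p s} = A} \<le> K" for A
      using card_mono[of "{..<K}" "{h\<in>{..<K}. {s \<in> U. h < p s} = A}"] by auto
    then show ?thesis by (auto simp: mul_def)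
  qed
  have "(\<Sum>p\<in>F. \<rho> ^ (\<Sum>s\<in>U. p s)) = (\<Sum>p\<in>F. \<Prod>A\<in>\<A>. (\<rho> ^ card A) ^ mul p A)"
    by (intro sum.cong refl) (simp add: tot power_sum power_mult[symmetric] mult.commute)
  also have "\<dots> = (\<Sum>m\<in>mul ` F. \<Prod>A\<in>\<A>. (\<rho> ^ card A) ^ m A)"
    by (simp add: sum.reindex[OF inj])
  \<comment> \<open>Dropping the constraint that the multiplicities come from some
    \<open>p \<in> F\<close> makes the sum factor into truncated geometric series.\<close>
  also have "\<dots> \<le> (\<Sum>m\<in>\<A> \<rightarrow>\<^sub>E {..K}. \<Prod>A\<in>\<A>. (\<rho> ^ card A) ^ m A)"
    using mulE Fam(1) \<rho> by (intro sum_mono2 finite_PiE prod_nonneg) auto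
  also have "\<dots> = (\<Prod>A\<in>\<A>. \<Sum>j\<le>K. (\<rho> ^ card A) ^ j)"
    using Fam(1) by (intro prod_sum_PiE[symmetric]) auto
  also have "\<dots> \<le> (\<Prod>A\<in>\<A>. exp (\<rho> ^ card A / (1 - \<rho>)))"
  proof (rule prod_mono, intro conjI)
    fix A assume A: "A \<in> \<A>"
    define x where "x = \<rho> ^ card A"
    \<comment> \<open>Nonempty \<open>A\<close> gives \<open>\<rho> ^ card A \<le> \<rho>\<close>,
      which bounds \<open>1 - x\<close> from below uniformly in \<open>A\<close>.\<close>
    have "finite A" "A \<noteq> {}" using Fam(2)[OF A] U finite_subset by blast+
    then have "card A \<ge> 1" by (simp add: Suc_leI card_gt_0_iff)
    then have x: "0 < x" "x \<le> \<rho>" using \<rho> power_decreasing[of 1 "card A" \<rho>] by (auto simp: x_def)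
    show "0 \<le> (\<Sum>j\<le>K. (\<rho> ^ card A) ^ j)" using \<rho> by (intro sum_nonneg) auto
    have "(\<Sum>j\<le>K. x ^ j) \<le> 1 / (1 - x)" using x \<rho> by (intro geometric_sum_le) auto
    also have "\<dots> = 1 + x / (1 - x)" using x \<rho> by (simp add: field_simps)
    also have "\<dots> \<le> 1 + x / (1 - \<rho>)" using x \<rho> by (intro add_left_mono divide_left_mono) auto
    also have "\<dots> \<le> exp (x / (1 - \<rho>))" by (rule exp_ge_add_one_self)
    finally show "(\<Sum>j\<le>K. (\<rho> ^ card A) ^ j) \<le> exp (\<rho> ^ card A / (1 - \<rho>))" by (simp add: x_def)
  qed
  also have "\<dots> = exp ((\<Sum>A\<in>\<A>. \<rho> ^ card A) / (1 - \<rho>))"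
    using Fam(1) by (simp add: exp_sum[symmetric] sum_divide_distrib)
  finally show ?thesis .
qed

text \<open>The level sets of a weakly decreasing sequence are initial segments, one for each
  length, so the exponent in the level-set bound is a geometric series. The result is uniform in
  \<open>n\<close> and \<open>K\<close>.\<close>

lemma sum_partitions_le:
  fixes \<rho> :: real
  assumes \<rho>: "0 < \<rho>" "\<rho> < 1" and F: "F \<subseteq> {..<n::nat} \<rightarrow>\<^sub>E {..K}"
    and anti: "\<And>p i j. p \<in> F \<Longrightarrow> i \<le> j \<Longrightarrow> j < n \<Longrightarrow> p j \<le> p i"
  shows "(\<Sum>p\<in>F. \<rho> ^ (\<Sum>i<n. p i)) \<le> exp (1 / (1 - \<rho>)\<^sup>2)"
proof -
  define \<A> where "\<A> = (\<lambda>j. {..<j}) ` {1..n}"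
  have lev: "{i \<in> {..<n}. h < p i} \<in> \<A>" if "p \<in> F" "{i \<in> {..<n}. h < p i} \<noteq> {}" for p h
  proof -
    let ?A = "{i \<in> {..<n}. h < p i}"
    have mx: "Max ?A \<in> ?A" using that by (intro Max_in) auto
    have "?A = {..<Suc (Max ?A)}"
    proof (intro set_eqI iffI)
      fix i assume "i \<in> {..<Suc (Max ?A)}"
      then show "i \<in> ?A" using anti[OF that(1), of i "Max ?A"] mx by auto
    next
      fix i assume "i \<in> ?A"
      then have "i \<le> Max ?A" by (intro Max_ge) auto
      then show "i \<in> {..<Suc (Max ?A)}" by simp
    qed
    moreover have "Suc (Max ?A) \<in> {1..n}" using mx by auto
    ultimately show ?thesis unfolding \<A>_def by blast
  qed
  have "(\<Sum>A\<in>\<A>. \<rho> ^ card A) = (\<Sum>j\<in>{1..n}. \<rho> ^ j)"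
    unfolding \<A>_def by (subst sum.reindex) (auto simp: inj_on_def)
  also have "\<dots> \<le> (\<Sum>j\<le>n. \<rho> ^ j)" using \<rho> by (intro sum_mono2) auto
  also have "\<dots> \<le> 1 / (1 - \<rho>)" using \<rho> by (intro geometric_sum_le) auto
  finally have s: "(\<Sum>A\<in>\<A>. \<rho> ^ card A) \<le> 1 / (1 - \<rho>)" .
  have "(\<Sum>p\<in>F. \<rho> ^ (\<Sum>i<n. p i)) \<le> exp ((\<Sum>A\<in>\<A>. \<rho> ^ card A) / (1 - \<rho>))"
    by (rule sum_level_sets_le[OF _ _ _ F]) (use lev \<rho> in \<open>auto simp: \<A>_def lessThan_empty_iff\<close>)
  also have "\<dots> \<le> exp ((1 / (1 - \<rho>)) / (1 - \<rho>))"
    using divide_right_mono[OF s, of "1 - \<rho>"] \<rho> by simp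
  finally show ?thesis by (simp add: power2_eq_square)
qed

lemma down_closed_nat_interval:
  fixes R :: "nat set"
  assumes fin: "finite R" and down: "\<And>i j. j \<in> R \<Longrightarrow> i \<le> j \<Longrightarrow> i \<in> R"
  shows "R = {..<card R}"
proof (cases "R = {}")
  case False
  define k where "k = Max R"
  have k: "k \<in> R" unfolding k_def by (rule Max_in[OF fin False])
  have R: "R = {..k}" using down[OF k] Max_ge[OF fin] unfolding k_def by auto
  show ?thesis by (simp add: R lessThan_Suc_atMost)
qed simp

text \<open>Plane partitions in an \<open>n\<close> by \<open>m\<close> by \<open>K\<close> box,
  with the largest entry at \<open>(0, 0)\<close>.\<close>

definition antitone_grids :: "nat \<Rightarrow> nat \<Rightarrow> nat \<Rightarrow> (nat \<times> nat \<Rightarrow> nat) set" where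
  "antitone_grids n m K = {p \<in> {..<n} \<times> {..<m} \<rightarrow>\<^sub>E {..K}.
     \<forall>i j i' j'. i \<le> i' \<longrightarrow> i' < n \<longrightarrow> j \<le> j' \<longrightarrow> j' < m \<longrightarrow> p (i', j') \<le> p (i, j)}"

text \<open>A crude bound for MacMahon's product; the nested exponential records the two uses of the
  level-set bound, for partitions and then for plane partitions.\<close>

definition grid_const :: "real \<Rightarrow> real" where
  "grid_const \<rho> = exp (exp (1 / (1 - \<rho>)\<^sup>2) / (1 - \<rho>))"

text \<open>The level sets of a plane partition are Young diagrams. A diagram is encoded by its row
  lengths, a partition of its number of cells, so the sum over diagrams is bounded by the sum over
  partitions.\<close>

lemma sum_antitone_grids_le:
  fixes \<rho> :: real
  assumes \<rho>: "0 < \<rho>" "\<rho> < 1"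
  shows "(\<Sum>p\<in>antitone_grids n m K. \<rho> ^ (\<Sum>s\<in>{..<n} \<times> {..<m}. p s)) \<le> grid_const \<rho>"
proof -
  let ?U = "{..<n} \<times> {..<m}"
  define \<A> where "\<A> = {A. A \<subseteq> ?U \<and> A \<noteq> {} \<and>
      (\<forall>i j i' j'. (i', j') \<in> A \<longrightarrow> i \<le> i' \<longrightarrow> j \<le> j' \<longrightarrow> (i, j) \<in> A)}"
  define row where "row A = (\<lambda>i\<in>{..<n}. card {j. (i, j) \<in> A})" for A :: "(nat \<times> nat) set"
  have AU: "A \<subseteq> ?U" "A \<noteq> {}" if "A \<in> \<A>" for A using that unfolding \<A>_def by blast+
  have Ad: "(i, j) \<in> A" if "A \<in> \<A>" "(i', j') \<in> A" "i \<le> i'" "j \<le> j'" for A i j i' j'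
    using that unfolding \<A>_def by blast
  have Am: "{j. (i, j) \<in> A} \<subseteq> {..<m}" if "A \<in> \<A>" for A i
  proof
    fix j assume "j \<in> {j. (i, j) \<in> A}"
    then have "(i, j) \<in> ?U" using subsetD[OF AU(1)[OF that], of "(i, j)"] by simp
    then show "j \<in> {..<m}" by simp
  qed
  have An: "i < n" if "A \<in> \<A>" "(i, j) \<in> A" for A i j
    using subsetD[OF AU(1)[OF that(1)] that(2)] by simp
  have finA: "finite \<A>" by (rule finite_subset[of _ "Pow ?U"]) (use AU(1) in auto)
  have rowset: "{j. (i, j) \<in> A} = {..<row A i}" if A: "A \<in> \<A>" and i: "i < n" for A i
  proof -
    let ?R = "{j. (i, j) \<in> A}"
    have fin: "finite ?R" by (rule finite_subset[OF Am[OF A]]) simp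
    have down: "j \<in> ?R" if "j' \<in> ?R" "j \<le> j'" for j j' using Ad[OF A, of i j' i j] that by simp
    have "?R = {..<card ?R}" by (rule down_closed_nat_interval[OF fin]) (rule down)
    then show ?thesis using i by (simp add: row_def)
  qed
  have cardA: "card A = (\<Sum>i<n. row A i)" if A: "A \<in> \<A>" for A
  proof -
    have eq: "A = (SIGMA i:{..<n}. {j. (i, j) \<in> A})" using An[OF A] by auto
    have "finite {j. (i, j) \<in> A}" for i by (rule finite_subset[OF Am[OF A]]) simp
    then have "card (SIGMA i:{..<n}. {j. (i, j) \<in> A}) = (\<Sum>i<n. card {j. (i, j) \<in> A})"
      by (intro card_SigmaI) auto
    then have "card A = (\<Sum>i<n. card {j. (i, j) \<in> A})" by (subst eq)
    then show ?thesis by (simp add: row_def)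
  qed
  have inj: "inj_on row \<A>"
  proof (rule inj_onI)
    fix A B assume AB: "A \<in> \<A>" "B \<in> \<A>" "row A = row B"
    have "(i, j) \<in> A \<longleftrightarrow> (i, j) \<in> B" for i j
    proof (cases "i < n")
      case True
      then show ?thesis using rowset[OF AB(1) True] rowset[OF AB(2) True] AB(3)
        by (metis mem_Collect_eq)
    next
      case False
      then show ?thesis using An[OF AB(1)] An[OF AB(2)] by blast
    qed
    then show "A = B" by auto
  qed
  have rowE: "row ` \<A> \<subseteq> {..<n} \<rightarrow>\<^sub>E {..m}"
  proof -
    have "card {j. (i, j) \<in> A} \<le> m" if "A \<in> \<A>" for A i
      using card_mono[OF _ Am[OF that], of i] by simp
    then show ?thesis by (auto simp: row_def split: if_splits)
  qed
  have "(\<Sum>A\<in>\<A>. \<rho> ^ card A) = (\<Sum>r\<in>row ` \<A>. \<rho> ^ (\<Sum>i<n. r i))"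
    by (subst sum.reindex[OF inj]) (simp add: cardA)
  also have "\<dots> \<le> exp (1 / (1 - \<rho>)\<^sup>2)"
  proof (rule sum_partitions_le[OF \<rho> rowE])
    fix r i i' assume "r \<in> row ` \<A>" and ii: "i \<le> i'" "i' < n"
    then obtain A where A: "A \<in> \<A>" "r = row A" by blast
    have "{j. (i', j) \<in> A} \<subseteq> {j. (i, j) \<in> A}" using Ad[OF A(1) _ ii(1)] by blast
    then show "r i' \<le> r i" using rowset[OF A(1)] ii A(2) by (metis lessThan_subset_iff le_less_trans)
  qed
  finally have s: "(\<Sum>A\<in>\<A>. \<rho> ^ card A) \<le> exp (1 / (1 - \<rho>)\<^sup>2)" .
  have "(\<Sum>p\<in>antitone_grids n m K. \<rho> ^ (\<Sum>s\<in>?U. p s)) \<le> exp ((\<Sum>A\<in>\<A>. \<rho> ^ card A) / (1 - \<rho>))"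
  proof (rule sum_level_sets_le[of _ \<A>, OF _ finA _ _ _ \<rho>])
    show "antitone_grids n m K \<subseteq> ?U \<rightarrow>\<^sub>E {..K}" by (auto simp: antitone_grids_def)
    fix p h assume p: "p \<in> antitone_grids n m K" and ne: "{s \<in> ?U. h < p s} \<noteq> {}"
    have "(i, j) \<in> {s \<in> ?U. h < p s}" if "(i', j') \<in> {s \<in> ?U. h < p s}" "i \<le> i'" "j \<le> j'" for i j i' j'
    proof -
      have "p (i', j') \<le> p (i, j)" using p that unfolding antitone_grids_def by simp
      then show ?thesis using that by auto
    qed
    then show "{s \<in> ?U. h < p s} \<in> \<A>" unfolding \<A>_def using ne by blast
  qed (use AU in auto)
  also have "\<dots> \<le> grid_const \<rho>"
    unfolding grid_const_def using divide_right_mono[OF s, of "1 - \<rho>"] \<rho> by simp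
  finally show ?thesis .
qed

section \<open>The abstract Peierls estimate\<close>

text \<open>The gain \<open>\<sigma>\<^sup>2\<close> per unit of deviation is split in two. One
  factor \<open>\<sigma>\<close> gives at most \<open>\<sigma> ^ k\<close> in total, because the
  corner entry alone is at least \<open>k\<close>. The other pays for the entropy: \<open>X\<close>
  is determined by \<open>(\<Phi> X, d X)\<close>, so the sum over \<open>E\<close> is dominated by
  the product of the sums over \<open>\<Omega>\<close> and over all plane partitions in the
  box.\<close>

lemma peierls_bound:
  fixes W :: "'a \<Rightarrow> real" and \<sigma> :: real
  assumes fin: "finite \<Omega>" and W: "\<And>X. X \<in> \<Omega> \<Longrightarrow> 0 \<le> W X" and \<sigma>: "0 < \<sigma>" "\<sigma> < 1"
    and E: "E \<subseteq> \<Omega>" and \<Phi>: "\<And>X. X \<in> E \<Longrightarrow> \<Phi> X \<in> \<Omega>"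
    and d: "\<And>X. X \<in> E \<Longrightarrow> d X \<in> antitone_grids n m K"
    and corner: "0 < n" "0 < m" "\<And>X. X \<in> E \<Longrightarrow> k \<le> d X (0, 0)"
    and inj: "inj_on (\<lambda>X. (\<Phi> X, d X)) E"
    and ratio: "\<And>X. X \<in> E \<Longrightarrow> W X \<le> W (\<Phi> X) * (\<sigma>\<^sup>2) ^ (\<Sum>s\<in>{..<n} \<times> {..<m}. d X s)"
  shows "(\<Sum>X\<in>E. W X) \<le> grid_const \<sigma> * \<sigma> ^ k * (\<Sum>X\<in>\<Omega>. W X)"
proof -
  let ?U = "{..<n} \<times> {..<m}"
  let ?G = "antitone_grids n m K"
  have finG: "finite ?G"
    by (rule finite_subset[of _ "?U \<rightarrow>\<^sub>E {..K}"]) (auto simp: antitone_grids_def intro: finite_PiE)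
  have "(\<Sum>X\<in>E. W X) \<le> (\<Sum>X\<in>E. \<sigma> ^ k * (W (\<Phi> X) * \<sigma> ^ (\<Sum>s\<in>?U. d X s)))"
  proof (rule sum_mono)
    fix X assume X: "X \<in> E"
    let ?s = "\<Sum>s\<in>?U. d X s"
    have "d X (0, 0) \<le> ?s" using corner(1,2) by (intro member_le_sum) auto
    then have "k \<le> ?s" using corner(3)[OF X] by simp
    then have "\<sigma> ^ ?s \<le> \<sigma> ^ k" using \<sigma> by (intro power_decreasing) auto
    then have "(\<sigma>\<^sup>2) ^ ?s \<le> \<sigma> ^ k * \<sigma> ^ ?s"
      using \<sigma> by (simp add: power_mult[symmetric] mult.commute power_add[symmetric] mult_2_right power_mult_distrib power2_eq_square)
    then have "W (\<Phi> X) * (\<sigma>\<^sup>2) ^ ?s \<le> W (\<Phi> X) * (\<sigma> ^ k * \<sigma> ^ ?s)"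
      using W[OF \<Phi>[OF X]] by (intro mult_left_mono)
    then show "W X \<le> \<sigma> ^ k * (W (\<Phi> X) * \<sigma> ^ ?s)" using ratio[OF X] by (simp add: mult_ac)
  qed
  also have "\<dots> = \<sigma> ^ k * (\<Sum>X\<in>E. W (\<Phi> X) * \<sigma> ^ (\<Sum>s\<in>?U. d X s))" by (simp add: sum_distrib_left)
  also have "(\<Sum>X\<in>E. W (\<Phi> X) * \<sigma> ^ (\<Sum>s\<in>?U. d X s)) =
      (\<Sum>(Y, p)\<in>(\<lambda>X. (\<Phi> X, d X)) ` E. W Y * \<sigma> ^ (\<Sum>s\<in>?U. p s))"
    by (simp add: sum.reindex[OF inj])
  also have "\<dots> \<le> (\<Sum>(Y, p)\<in>\<Omega> \<times> ?G. W Y * \<sigma> ^ (\<Sum>s\<in>?U. p s))"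
    using fin finG \<Phi> d W \<sigma> by (intro sum_mono2) auto
  also have "\<dots> = (\<Sum>Y\<in>\<Omega>. W Y) * (\<Sum>p\<in>?G. \<sigma> ^ (\<Sum>s\<in>?U. p s))"
    by (simp add: sum_product sum.cartesian_product)
  also have "\<dots> \<le> (\<Sum>Y\<in>\<Omega>. W Y) * grid_const \<sigma>"
    using W sum_antitone_grids_le[OF \<sigma>] by (intro mult_left_mono sum_nonneg) auto
  finally show ?thesis using \<sigma> by (simp add: mult_ac mult_left_mono)
qed

subsection \<open>Holes as a plane partition\<close>

context
  fixes T S N :: int and X :: "int \<Rightarrow> int \<Rightarrow> int"
  assumes X: "X \<in> path_ensembles T S N"
begin

lemma path_step:
  "i \<in> {1..N} \<Longrightarrow> t \<in> {0..<T} \<Longrightarrow> X (t + 1) i = X t i \<or> X (t + 1) i = X t i + 1"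
  using X unfolding path_ensembles_def by blast

lemma path_gap:
  assumes "t \<in> {0..T}" "1 \<le> i" "i \<le> j" "j \<le> N"
  shows "X t i + (j - i) \<le> X t j"
proof -
  have sm: "strict_mono_on {1..N} (X t)" using X assms(1) unfolding path_ensembles_def by blast
  have "j \<le> N \<longrightarrow> X t i + (j - i) \<le> X t j"
    using assms(3)
  proof (induction j rule: int_ge_induct)
    case (step j)
    have "X t j < X t (j + 1)" if "j + 1 \<le> N"
      using sm that step(1) assms(2) by (intro strict_mono_onD[OF sm]) auto
    then show ?case using step by auto
  qed simp
  then show ?thesis using assms(4) by simp
qed

text \<open>\<open>X t i - i + 1\<close> is the number of up-steps of path \<open>i\<close> up to
  time \<open>t\<close>, the coordinate used from here on. The level range of the lowest and the
  highest path and the gaps between paths bound it.\<close>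

lemma path_bounds:
  assumes "t \<in> {0..T}" "i \<in> {1..N}"
  shows "max 0 (t + S - T) \<le> X t i - i + 1" "X t i - i + 1 \<le> min t S"
proof -
  have "X t 1 \<in> level_range T S N t" "X t N \<in> level_range T S N t"
    using assms by (auto intro!: ensemble_in_level_range[OF X])
  moreover have "X t 1 + (i - 1) \<le> X t i" "X t i + (N - i) \<le> X t N"
    using assms by (auto intro!: path_gap)
  ultimately show "max 0 (t + S - T) \<le> X t i - i + 1" "X t i - i + 1 \<le> min t S"
    by (auto simp: level_range_def)
qed

end

lemma path_ensembles_extensional:
  assumes "X \<in> path_ensembles T S N" "Y \<in> path_ensembles T S N"
    and "\<And>t i. t \<in> {0..T} \<Longrightarrow> i \<in> {1..N} \<Longrightarrow> X t i = Y t i"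
  shows "X = Y"
proof (rule PiE_ext)
  show PE: "X \<in> {0..T} \<rightarrow>\<^sub>E ({1..N} \<rightarrow>\<^sub>E UNIV)" "Y \<in> {0..T} \<rightarrow>\<^sub>E ({1..N} \<rightarrow>\<^sub>E UNIV)"
    using assms(1,2) unfolding path_ensembles_def by blast+
  fix t assume t: "t \<in> {0..T}"
  show "X t = Y t"
    by (rule PiE_ext[OF PiE_mem[OF PE(1) t] PiE_mem[OF PE(2) t]]) (use assms(3) t in blast)
qed

text \<open>One cell for each of the \<open>S * (T - S)\<close> holes. The holes at time
  \<open>t\<close> belong to the cells with \<open>a + b = t\<close>.\<close>

definition hole_cells :: "int \<Rightarrow> int \<Rightarrow> (int \<times> int) set" where
  "hole_cells T S = {1..S} \<times> {0..T - S - 1}"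

text \<open>
  Row and column of the plane partition attached to an ensemble are \<open>a\<close> = the number of
  non-particle sites \<open>\<ge> 0\<close> up to and including the hole and \<open>b = t - a\<close>; its entry is the number
  of paths below the hole.
\<close>

definition entry :: "int \<Rightarrow> (int \<Rightarrow> int \<Rightarrow> int) \<Rightarrow> int \<times> int \<Rightarrow> int" where
  "entry N X = (\<lambda>(a, b). int (card {i\<in>{1..N}. X (a + b) i - i + 1 < a}))"

lemma down_closed_int_interval:
  fixes Z :: "int set"
  assumes "Z \<subseteq> {1..N}" and "\<And>i j. j \<in> Z \<Longrightarrow> 1 \<le> i \<Longrightarrow> i \<le> j \<Longrightarrow> i \<in> Z"
  shows "Z = {1..int (card Z)}"
proof (cases "Z = {}")
  case False
  have fin: "finite Z" using assms(1) finite_subset by blast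
  have M: "Max Z \<in> Z" using False fin by (rule Max_in[rotated])
  have "Z = {1..Max Z}"
  proof (intro set_eqI iffI)
    fix i assume "i \<in> Z"
    then show "i \<in> {1..Max Z}" using assms(1) Max_ge[OF fin] by auto
  next
    fix i assume "i \<in> {1..Max Z}"
    then show "i \<in> Z" using assms(2)[OF M] by simp
  qed
  moreover have "1 \<le> Max Z" using M assms(1) by auto
  ultimately show ?thesis by (metis card_atLeastAtMost_int diff_add_cancel int_nat_eq le_less
    less_le_trans zero_less_one)
qed simp

text \<open>Up-step counts increase weakly with the label, so the paths counted by
  \<open>entry\<close> form an initial segment of labels. Later comparisons go through this
  threshold form of \<open>entry\<close>.\<close>

lemma le_entry_iff:
  assumes X: "X \<in> path_ensembles T S N" and "a + b \<in> {0..T}" "i \<in> {1..N}"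
  shows "i \<le> entry N X (a, b) \<longleftrightarrow> X (a + b) i - i + 1 < a"
proof -
  let ?Z = "{i\<in>{1..N}. X (a + b) i - i + 1 < a}"
  have "?Z = {1..int (card ?Z)}"
  proof (rule down_closed_int_interval)
    fix i j assume "j \<in> ?Z" "1 \<le> i" "i \<le> j"
    then show "i \<in> ?Z" using path_gap[OF X assms(2), of i j] by auto
  qed auto
  then have "i \<in> ?Z \<longleftrightarrow> i \<in> {1..int (card ?Z)}" by simp
  then show ?thesis using assms(3) by (simp add: entry_def)
qed

lemma entry_bounds:
  shows "0 \<le> entry N X s" and "0 \<le> N \<Longrightarrow> entry N X s \<le> N"
proof -
  obtain a b where s: "s = (a, b)" by fastforce
  show "0 \<le> entry N X s" by (simp add: entry_def s)
  have "card {i\<in>{1..N}. X (a + b) i - i + 1 < a} \<le> card {1..N}" by (intro card_mono) auto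
  then show "entry N X s \<le> N" if "0 \<le> N" using that by (simp add: entry_def s)
qed

lemma cell_time:
  "(a, b) \<in> hole_cells T S \<Longrightarrow> a + b \<in> {0..T}"
  by (auto simp: hole_cells_def)

lemma entry_unique:
  assumes X: "X \<in> path_ensembles T S N" and t: "a + b \<in> {0..T}" and v: "v \<in> {0..N}"
    and iff: "\<And>i. i \<in> {1..N} \<Longrightarrow> i \<le> v \<longleftrightarrow> X (a + b) i - i + 1 < a"
  shows "entry N X (a, b) = v"
proof -
  have "{i\<in>{1..N}. X (a + b) i - i + 1 < a} = {1..v}"
  proof (rule set_eqI)
    fix i show "i \<in> {i\<in>{1..N}. X (a + b) i - i + 1 < a} \<longleftrightarrow> i \<in> {1..v}"
      using iff[of i] v by (cases "i \<in> {1..N}") auto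
  qed
  then show ?thesis using v by (simp add: entry_def)
qed

text \<open>Path steps are 0 or 1, so passing from time \<open>a + b\<close> to
  \<open>a' + b'\<close> raises a path by at most \<open>a' - a\<close>: forward in time because
  \<open>b' \<le> b\<close>, backward because positions do not increase. A path below the hole of
  the first cell is then below the hole of the second.\<close>

lemma entry_mono:
  assumes X: "X \<in> path_ensembles T S N" "0 \<le> N"
    and cells: "(a, b) \<in> hole_cells T S" "(a', b') \<in> hole_cells T S" and le: "a \<le> a'" "b' \<le> b"
  shows "entry N X (a, b) \<le> entry N X (a', b')"
proof -
  note t = cell_time[OF cells(1)] cell_time[OF cells(2)]
  define v where "v = entry N X (a, b)"
  have v: "0 \<le> v" "v \<le> N" using entry_bounds X(2) by (auto simp: v_def)
  have slope: "X s i \<le> X r i \<and> X r i \<le> X s i + (r - s)" if "i \<in> {1..N}" "0 \<le> s" "s \<le> r" "r \<le> T" for i s r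
  proof -
    have "r \<le> T \<longrightarrow> X s i \<le> X r i \<and> X r i \<le> X s i + (r - s)"
      using that(3)
    proof (induction r rule: int_ge_induct)
      case (step r)
      then show ?case using path_step[OF X(1) that(1), of r] that(2) by auto
    qed simp
    then show ?thesis using that(4) by simp
  qed
  show ?thesis
  proof (cases "v = 0")
    case True
    then show ?thesis using entry_bounds by (metis v_def)
  next
    case False
    then have i: "v \<in> {1..N}" using v by auto
    have "X (a + b) v - v + 1 < a" using le_entry_iff[OF X(1) t(1) i] by (simp add: v_def)
    moreover have "X (a' + b') v - a' \<le> X (a + b) v - a"
      using slope[OF i, of "a + b" "a' + b'"] slope[OF i, of "a' + b'" "a + b"] t le
      by (cases "a + b \<le> a' + b'") auto
    ultimately show ?thesis using le_entry_iff[OF X(1) t(2) i] by (simp add: v_def)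
  qed
qed

lemma entry_inj:
  assumes X: "X \<in> path_ensembles T S N" and Y: "Y \<in> path_ensembles T S N"
    and eq: "\<And>s. s \<in> hole_cells T S \<Longrightarrow> entry N X s = entry N Y s"
  shows "X = Y"
proof -
  have le: "Y t i \<le> X t i"
    if X: "X \<in> path_ensembles T S N" and Y: "Y \<in> path_ensembles T S N"
      and eq: "\<And>s. s \<in> hole_cells T S \<Longrightarrow> entry N X s = entry N Y s"
      and t: "t \<in> {0..T}" and i: "i \<in> {1..N}" for X Y t i
  proof (rule ccontr)
    assume less: "\<not> ?thesis"
    \<comment> \<open>At time \<open>t\<close> path \<open>i\<close> has \<open>a - 1\<close>
      up-steps in \<open>X\<close> and at least \<open>a\<close> in \<open>Y\<close>, so the entry
      in row \<open>a\<close> separates the two ensembles.\<close>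
    define a where "a = X t i - i + 2"
    have "(a, t - a) \<in> hole_cells T S"
      using less path_bounds[OF X t i] path_bounds[OF Y t i] by (auto simp: hole_cells_def a_def)
    then have "entry N X (a, t - a) = entry N Y (a, t - a)" by (rule eq)
    then show False
      using le_entry_iff[OF X, of a "t - a" i] le_entry_iff[OF Y, of a "t - a" i] t i less
      by (simp add: a_def)
  qed
  show ?thesis
    by (rule path_ensembles_extensional[OF X Y]) (metis le[OF X Y eq] le[OF Y X eq[symmetric]] order_antisym)
qed

text \<open>A hole at height \<open>x\<close> with \<open>v\<close> paths below it is the empty site
  number \<open>x - v + 1\<close>, counted from height 0. This recovers the row \<open>a\<close>,
  and the column is \<open>t - a\<close>; so \<open>?g\<close> is a left inverse.\<close>

lemma holes_bij_betw:
  assumes X: "X \<in> path_ensembles T S N" and N: "0 \<le> N"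
  shows "bij_betw (\<lambda>(a, b). (a + b, entry N X (a, b) + a - 1)) (hole_cells T S) (holes T S N X)"
proof -
  let ?f = "\<lambda>(a, b). (a + b, entry N X (a, b) + a - 1)"
  let ?g = "\<lambda>(t, x). let a = x - int (card {i\<in>{1..N}. X t i < x}) + 1 in (a, t - a)"
  have below: "i \<le> entry N X (a, b) \<longleftrightarrow> X (a + b) i < entry N X (a, b) + a - 1"
       "X (a + b) i \<noteq> entry N X (a, b) + a - 1"
    if ab: "(a, b) \<in> hole_cells T S" and i: "i \<in> {1..N}" for a b i
    using le_entry_iff[OF X cell_time[OF ab] i] i by auto
  have gf: "?g (?f s) = s" if "s \<in> hole_cells T S" for s
  proof -
    obtain a b where s: "s = (a, b)" by fastforce
    define v where "v = entry N X (a, b)"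
    have "{i\<in>{1..N}. X (a + b) i < v + a - 1} = {1..v}"
    proof (rule set_eqI)
      fix i show "i \<in> {i\<in>{1..N}. X (a + b) i < v + a - 1} \<longleftrightarrow> i \<in> {1..v}"
        using below(1)[of a b i] that entry_bounds(2)[OF N, of X "(a, b)"]
        unfolding s v_def by (cases "i \<in> {1..N}") auto
    qed
    then have "int (card {i\<in>{1..N}. X (a + b) i < v + a - 1}) = v"
      using entry_bounds(1)[of N X "(a, b)"] by (simp add: v_def)
    then show ?thesis unfolding s by (simp add: Let_def flip: v_def)
  qed
  have f_in: "?f s \<in> holes T S N X" if sin: "s \<in> hole_cells T S" for s
  proof -
    obtain a b where s: "s = (a, b)" by fastforce
    have "entry N X (a, b) + a - 1 \<notin> X (a + b) ` {1..N}"
      using below(2)[of a b] that unfolding s by (metis (no_types, lifting) imageE)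
    moreover have "entry N X (a, b) + a - 1 \<in> level_range T S N (a + b)"
      using sin entry_bounds(1)[of N X "(a, b)"] entry_bounds(2)[OF N, of X "(a, b)"]
      unfolding s by (auto simp: level_range_def hole_cells_def)
    ultimately show ?thesis using cell_time[of a b T S] sin unfolding s by (simp add: holes_def)
  qed
  have surj: "\<exists>s\<in>hole_cells T S. ?f s = p" if p: "p \<in> holes T S N X" for p
  proof -
    obtain t x where tx: "p = (t, x)" by fastforce
    have t: "t \<in> {0..T}" and x: "x \<in> level_range T S N t" "x \<notin> X t ` {1..N}"
      using p by (auto simp: holes_def tx)
    let ?Z = "{i\<in>{1..N}. X t i < x}"
    define v where "v = int (card ?Z)"
    define a where "a = x - v + 1"
    have Z: "?Z = {1..v}"
      unfolding v_def
    proof (rule down_closed_int_interval)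
      fix i j assume "j \<in> ?Z" "1 \<le> i" "i \<le> j"
      then show "i \<in> ?Z" using path_gap[OF X t, of i j] by auto
    qed auto
    have "card ?Z \<le> card {1..N}" by (rule card_mono) auto
    then have vN: "0 \<le> v" "v \<le> N" using N unfolding v_def by simp_all
    have lo: "X t i - i + 1 < a" if "i \<in> {1..N}" "i \<le> v" for i
    proof -
      have "v \<in> ?Z" using Z that by auto
      then show ?thesis using path_gap[OF X t, of i v] that by (auto simp: a_def)
    qed
    have hi: "a \<le> X t i - i + 1" if "i \<in> {1..N}" "v < i" for i
    proof -
      have "v + 1 \<notin> ?Z" by (subst Z) simp
      then have "x \<le> X t (v + 1)" using that vN by auto
      moreover have "x \<noteq> X t (v + 1)" using x(2) that vN by auto
      ultimately show ?thesis using path_gap[OF X t, of "v + 1" i] that vN by (auto simp: a_def)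
    qed
    \<comment> \<open>The hole is compared with the path just below it, or with the bottom of the
      level range if there is none; the upper bounds on \<open>a\<close> use the path just above, or
      the top, in the same way.\<close>
    have "1 \<le> a \<and> t + S - T < a"
    proof (cases "v = 0")
      case True
      then show ?thesis using x(1) by (auto simp: a_def level_range_def)
    next
      case False
      then show ?thesis using lo[of v] path_bounds(1)[OF X t, of v] vN by auto
    qed
    moreover have "a \<le> S \<and> a \<le> t"
    proof (cases "v = N")
      case True
      then show ?thesis using x(1) by (auto simp: a_def level_range_def)
    next
      case False
      then show ?thesis using hi[of "v + 1"] path_bounds(2)[OF X t, of "v + 1"] vN by auto
    qed
    ultimately have cell: "(a, t - a) \<in> hole_cells T S" by (auto simp: hole_cells_def)
    have "entry N X (a, t - a) = v"
    proof (rule entry_unique[OF X])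
      fix i assume "i \<in> {1..N}"
      then show "i \<le> v \<longleftrightarrow> X (a + (t - a)) i - i + 1 < a" using lo[of i] hi[of i] by force
    qed (use t vN in auto)
    then show ?thesis using cell by (intro bexI[of _ "(a, t - a)"]) (auto simp: tx a_def)
  qed
  have "inj_on ?f (hole_cells T S)" using gf by (intro inj_on_inverseI[where g = ?g]) blast
  moreover have "?f ` hole_cells T S = holes T S N X"
  proof
    show "?f ` hole_cells T S \<subseteq> holes T S N X" using f_in by blast
    show "holes T S N X \<subseteq> ?f ` hole_cells T S" using surj by (metis (no_types, lifting) image_eqI subsetI)
  qed
  ultimately show ?thesis by (simp add: bij_betw_def)
qed

section \<open>Cutting an ensemble along a lattice path\<close>

text \<open>The minimum or maximum of two integer sequences with steps 0 or 1 again has such steps,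
  and cutting all up-step counts by the same \<open>g\<close> keeps them weakly increasing in the
  label. A cut by \<open>min\<close> can only raise entries, a cut by \<open>max\<close> can only
  lower them.\<close>

lemma path_ensemble_modify:
  assumes X: "X \<in> path_ensembles T S N"
    and h: "h \<in> {min, max}" and g: "\<And>t. t \<in> {0..<T} \<Longrightarrow> g (t + 1) = g t \<or> g (t + 1) = g t + 1"
    and ends: "h 0 (g 0) = 0" "h S (g T) = S" and T: "0 \<le> T"
  shows "(\<lambda>t\<in>{0..T}. \<lambda>i\<in>{1..N}. h (X t i - i + 1) (g t) + i - 1) \<in> path_ensembles T S N" (is "?Y \<in> _")
proof -
  have b: "X 0 i = i - 1" "X T i = S + i - 1" if "i \<in> {1..N}" for i
    using X that unfolding path_ensembles_def by blast+
  have Yv: "?Y t i = h (X t i - i + 1) (g t) + i - 1" if "t \<in> {0..T}" "i \<in> {1..N}" for t i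
    using that by simp
  have "?Y \<in> {0..T} \<rightarrow>\<^sub>E ({1..N} \<rightarrow>\<^sub>E UNIV)" by auto
  moreover have "\<forall>i\<in>{1..N}. ?Y 0 i = i - 1 \<and> ?Y T i = S + i - 1"
    using b T ends by (simp del: restrict_apply' add: restrict_apply)
  moreover have "\<forall>i\<in>{1..N}. \<forall>t\<in>{0..<T}. ?Y (t + 1) i = ?Y t i \<or> ?Y (t + 1) i = ?Y t i + 1"
  proof (intro ballI)
    fix i t assume it: "i \<in> {1..N}" "t \<in> {0..<T}"
    then have t: "t \<in> {0..T}" "t + 1 \<in> {0..T}" by auto
    have hs: "h u' w' = h u w \<or> h u' w' = h u w + 1"
      if "u' = u \<or> u' = u + 1" "w' = w \<or> w' = w + 1" for u u' w w'
      using h that by auto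
    have "X (t + 1) i - i + 1 = X t i - i + 1 \<or> X (t + 1) i - i + 1 = X t i - i + 1 + 1"
      using path_step[OF X it] by auto
    from hs[OF this g[OF it(2)]] show "?Y (t + 1) i = ?Y t i \<or> ?Y (t + 1) i = ?Y t i + 1"
      unfolding Yv[OF t(1) it(1)] Yv[OF t(2) it(1)] by arith
  qed
  moreover have "\<forall>t\<in>{0..T}. strict_mono_on {1..N} (?Y t)"
  proof (intro ballI strict_mono_onI)
    fix t i j assume *: "t \<in> {0..T}" "i \<in> {1..N}" "j \<in> {1..N}" "i < j"
    then show "?Y t i < ?Y t j"
      using Yv[of t i] Yv[of t j] path_gap[OF X *(1), of i j] h by (auto simp: min_def max_def)
  qed
  ultimately show ?thesis unfolding path_ensembles_def by blast
qed

subsection \<open>The Peierls estimate for rectangles\<close>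

text \<open>The real value at which the cosh weight of a cell is smallest. The shift
  \<open>z\<close>, later \<open>- ln (Im \<kappa>) / ln q\<close>, carries the dependence on
  \<open>\<kappa>\<close>.\<close>

definition cell_center :: "real \<Rightarrow> int \<Rightarrow> int \<times> int \<Rightarrow> real" where
  "cell_center z S = (\<lambda>(a, b). (real_of_int S + 1 + real_of_int b - real_of_int a) / 2 + z)"

text \<open>For purely imaginary \<open>\<kappa>\<close> the argument is
  \<open>u = \<i> * exp y\<close>, and \<open>- 1 / u\<close> has the same phase as
  \<open>u\<close>, so the two terms add up to a cosh.\<close>

lemma norm_qRacah_w:
  fixes q :: real and \<kappa> :: complex
  assumes q: "0 < q" "q < 1" and \<kappa>: "Re \<kappa> = 0" "0 < Im \<kappa>"
  shows "norm (qRacah_w q \<kappa> S j) =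
    2 * cosh (- ln q * (j - (real_of_int S + 1) / 2 + ln (Im \<kappa>) / ln q))"
proof -
  define y where "y = ln (Im \<kappa>) + (j - (real_of_int S + 1) / 2) * ln q"
  have e: "Im \<kappa> * q powr (j - (real_of_int S + 1) / 2) = exp y"
    using assms by (simp add: y_def exp_add powr_def)
  have k: "\<kappa> = \<i> * complex_of_real (Im \<kappa>)" using \<kappa> by (simp add: complex_eq_iff)
  have "\<kappa> * complex_of_real (q powr (j - (real_of_int S + 1) / 2)) = \<i> * complex_of_real (exp y)"
    by (subst k) (simp add: e[symmetric])
  then have "qRacah_w q \<kappa> S j = \<i> * complex_of_real (exp y + exp (- y))"
    by (simp add: qRacah_w_def Let_def exp_minus field_simps)
  then have "norm (qRacah_w q \<kappa> S j) = exp y + exp (- y)"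
    by (simp only: norm_mult norm_of_real) (simp add: add_nonneg_nonneg)
  also have "\<dots> = 2 * cosh (- y)" by (simp add: cosh_def)
  also have "- y = - ln q * (j - (real_of_int S + 1) / 2 + ln (Im \<kappa>) / ln q)"
    using q by (simp add: y_def field_simps)
  finally show ?thesis .
qed

text \<open>Indexing holes by cells makes the index set independent of \<open>X\<close>, so two
  ensembles can be compared cell by cell.\<close>

lemma norm_ensemble_weight:
  fixes q :: real and \<kappa> :: complex
  assumes q: "0 < q" "q < 1" and \<kappa>: "Re \<kappa> = 0" "0 < Im \<kappa>"
    and X: "X \<in> path_ensembles T S N" "0 \<le> N"
  shows "norm (ensemble_weight q \<kappa> T S N X) = (\<Prod>s\<in>hole_cells T S.
    2 * cosh (- ln q * (real_of_int (entry N X s) - cell_center (- ln (Im \<kappa>) / ln q) S s)))"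
proof -
  have "norm (ensemble_weight q \<kappa> T S N X) =
      (\<Prod>p\<in>holes T S N X. norm (qRacah_w q \<kappa> S (real_of_int (snd p) - real_of_int (fst p) / 2 + 1)))"
    by (simp add: ensemble_weight_def prod_norm case_prod_beta)
  also have "\<dots> = (\<Prod>s\<in>hole_cells T S. 2 * cosh (- ln q *
      (real_of_int (entry N X s) - cell_center (- ln (Im \<kappa>) / ln q) S s)))"
    unfolding prod.reindex_bij_betw[OF holes_bij_betw[OF X], symmetric]
  proof (rule prod.cong[OF refl])
    fix s :: "int \<times> int"
    obtain a b where s: "s = (a, b)" by fastforce
    have eq: "real_of_int (entry N X (a, b) + a - 1) - real_of_int (a + b) / 2 + 1 - (real_of_int S + 1) / 2
        + ln (Im \<kappa>) / ln q = real_of_int (entry N X (a, b)) - cell_center (- ln (Im \<kappa>) / ln q) S (a, b)"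
      by (simp add: cell_center_def field_simps)
    then show "norm (qRacah_w q \<kappa> S (real_of_int (snd (case s of (a, b) \<Rightarrow> (a + b, entry N X (a, b) + a - 1))) -
         real_of_int (fst (case s of (a, b) \<Rightarrow> (a + b, entry N X (a, b) + a - 1))) / 2 + 1)) =
      2 * cosh (- ln q * (real_of_int (entry N X s) - cell_center (- ln (Im \<kappa>) / ln q) S s))"
      unfolding norm_qRacah_w[OF q \<kappa>] s by (simp only: prod.case fst_conv snd_conv eq)
  qed
  finally show ?thesis .
qed

text \<open>All weights have the same phase, so norms may replace them: each quotient is positive
  and the quotients sum to 1, which makes the norm of the partition function the sum of the
  norms.\<close>

lemma measure_qRacah:
  assumes q: "0 < q" "Re \<kappa> = 0" "0 < Im \<kappa>" and S: "0 < S" "S < T"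
    and E: "E \<subseteq> path_ensembles T S N"
  shows "measure (qRacah_measure q \<kappa> T S N) E =
    (\<Sum>X\<in>E. norm (ensemble_weight q \<kappa> T S N X)) /
    (\<Sum>X\<in>path_ensembles T S N. norm (ensemble_weight q \<kappa> T S N X))"
proof -
  let ?P = "path_ensembles T S N" and ?W = "ensemble_weight q \<kappa> T S N"
    and ?Z = "partition_function q \<kappa> T S N"
  have Re: "Re (?W X / ?Z) = norm (?W X) / norm ?Z" if X: "X \<in> ?P" for X
  proof -
    obtain p where p: "p > 0" "?W X / ?Z = complex_of_real p"
      using weight_quotient_real(2)[OF q S X] by blast
    then show ?thesis by (metis Re_complex_of_real abs_of_pos norm_divide norm_of_real)
  qed
  have "(\<Sum>X\<in>?P. ?W X / ?Z) = 1"
    using weight_quotient_real(1)[OF q S] by (simp add: partition_function_def flip: sum_divide_distrib)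
  then have "(\<Sum>X\<in>?P. Re (?W X / ?Z)) = 1" by (metis Re_sum one_complex.simps(1))
  then have "(\<Sum>X\<in>?P. norm (?W X)) / norm ?Z = 1" using Re by (simp add: sum_divide_distrib)
  then have Z: "norm ?Z = (\<Sum>X\<in>?P. norm (?W X))" by (simp add: divide_eq_1_iff)
  have "emeasure (qRacah_measure q \<kappa> T S N) E = (\<Sum>X\<in>E. ennreal (Re (?W X / ?Z)))"
    unfolding qRacah_measure_def by (rule emeasure_point_measure_finite[OF finite_path_ensembles E])
  also have "\<dots> = (\<Sum>X\<in>E. ennreal (norm (?W X) / norm ?Z))"
    using Re E by (intro sum.cong) auto
  also have "\<dots> = ennreal (\<Sum>X\<in>E. norm (?W X) / norm ?Z)" by (rule sum_ennreal) simp
  finally have "measure (qRacah_measure q \<kappa> T S N) E = (\<Sum>X\<in>E. norm (?W X) / norm ?Z)"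
    by (simp add: measure_def sum_nonneg)
  then show ?thesis by (simp add: Z sum_divide_distrib)
qed

text \<open>The map \<open>c\<close> places the grid in the box with \<open>(0, 0)\<close> at the
  chosen cell, oriented so that deviations from \<open>e\<close> decrease away from it.
  \<open>\<Phi>\<close> resets the entries on the image to \<open>e\<close>, and only the cosh
  factors of these cells change.\<close>

lemma rectangle_bound:
  fixes c :: "nat \<times> nat \<Rightarrow> int \<times> int" and e :: int and \<sigma> :: real
  assumes q: "0 < q" "q < 1" and \<kappa>: "Re \<kappa> = 0" "0 < Im \<kappa>" and N: "0 \<le> N" and e: "e \<in> {0, N}"
    and \<sigma>: "0 < \<sigma>" "\<sigma> < 1" and nm: "0 < n" "0 < m"
    and E: "E \<subseteq> path_ensembles T S N" and \<Phi>: "\<And>X. X \<in> E \<Longrightarrow> \<Phi> X \<in> path_ensembles T S N"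
    and c: "inj_on c ({..<n} \<times> {..<m})" "c ` ({..<n} \<times> {..<m}) \<subseteq> hole_cells T S"
    and ent: "\<And>X s. X \<in> E \<Longrightarrow> s \<in> hole_cells T S \<Longrightarrow>
      entry N (\<Phi> X) s = (if s \<in> c ` ({..<n} \<times> {..<m}) then e else entry N X s)"
    and anti: "\<And>X i i' j j'. X \<in> E \<Longrightarrow> i \<le> i' \<Longrightarrow> i' < n \<Longrightarrow> j \<le> j' \<Longrightarrow> j' < m \<Longrightarrow>
      \<bar>e - entry N X (c (i', j'))\<bar> \<le> \<bar>e - entry N X (c (i, j))\<bar>"
    and corner: "\<And>X. X \<in> E \<Longrightarrow> k \<le> nat \<bar>e - entry N X (c (0, 0))\<bar>"
    and ratio: "\<And>X s. X \<in> E \<Longrightarrow> s \<in> c ` ({..<n} \<times> {..<m}) \<Longrightarrow>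
      cosh (- ln q * (real_of_int (entry N X s) - cell_center (- ln (Im \<kappa>) / ln q) S s)) \<le>
      cosh (- ln q * (real_of_int e - cell_center (- ln (Im \<kappa>) / ln q) S s)) *
        (\<sigma>\<^sup>2) ^ nat \<bar>e - entry N X s\<bar>"
  shows "(\<Sum>X\<in>E. norm (ensemble_weight q \<kappa> T S N X)) \<le>
    grid_const \<sigma> * \<sigma> ^ k * (\<Sum>X\<in>path_ensembles T S N. norm (ensemble_weight q \<kappa> T S N X))"
proof -
  let ?U = "{..<n} \<times> {..<m}" and ?D = "hole_cells T S"
    and ?C = "cell_center (- ln (Im \<kappa>) / ln q) S"
  define d where "d X = (\<lambda>s\<in>?U. nat \<bar>e - entry N X (c s)\<bar>)" for X
  have eb: "0 \<le> e" "e \<le> N" using e N by auto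
  show ?thesis
  proof (rule peierls_bound[where \<Phi> = \<Phi> and d = d and n = n and m = m and K = "nat N"])
    show "finite (path_ensembles T S N)" by (rule finite_path_ensembles)
    show "d X \<in> antitone_grids n m (nat N)" if X: "X \<in> E" for X
    proof -
      have "nat \<bar>e - entry N X (c s)\<bar> \<le> nat N" for s
        using entry_bounds(1)[of N X "c s"] entry_bounds(2)[OF N, of X "c s"] eb by auto
      then have "d X \<in> ?U \<rightarrow>\<^sub>E {..nat N}" by (simp add: d_def restrict_PiE_iff del: nat_le_eq_zle)
      moreover have "d X (i', j') \<le> d X (i, j)" if "i \<le> i'" "i' < n" "j \<le> j'" "j' < m" for i j i' j'
        using anti[OF X that] that by (simp add: d_def nat_mono)
      ultimately show ?thesis by (simp add: antitone_grids_def)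
    qed
    show "k \<le> d X (0, 0)" if "X \<in> E" for X using corner[OF that] nm by (simp add: d_def)
    show "inj_on (\<lambda>X. (\<Phi> X, d X)) E"
    proof (rule inj_onI)
      fix X Y assume XY: "X \<in> E" "Y \<in> E" "(\<Phi> X, d X) = (\<Phi> Y, d Y)"
      show "X = Y"
      proof (rule entry_inj)
        show "X \<in> path_ensembles T S N" "Y \<in> path_ensembles T S N" using XY E by auto
        fix s assume s: "s \<in> ?D"
        show "entry N X s = entry N Y s"
        proof (cases "s \<in> c ` ?U")
          case True
          then obtain r where r: "r \<in> ?U" "s = c r" by blast
          have "d X r = d Y r" using XY by simp
          then have "\<bar>e - entry N X s\<bar> = \<bar>e - entry N Y s\<bar>" using r by (simp add: d_def)
          \<comment> \<open>Since \<open>e\<close> is an endpoint of \<open>{0..N}\<close>, the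
            absolute deviation determines the entry.\<close>
          then show ?thesis
            using e entry_bounds(1)[of N X s] entry_bounds(2)[OF N, of X s]
              entry_bounds(1)[of N Y s] entry_bounds(2)[OF N, of Y s] by auto
        next
          case False
          then show ?thesis using ent[OF XY(1) s] ent[OF XY(2) s] XY(3) by simp
        qed
      qed
    qed
    fix X assume X: "X \<in> E"
    let ?p = "\<lambda>s. (\<sigma>\<^sup>2) ^ nat \<bar>e - entry N X s\<bar>"
    have finD: "finite ?D" by (simp add: hole_cells_def)
    have XP: "X \<in> path_ensembles T S N" using X E by blast
    have "norm (ensemble_weight q \<kappa> T S N X) =
        (\<Prod>s\<in>?D. 2 * cosh (- ln q * (real_of_int (entry N X s) - ?C s)))"
      by (rule norm_ensemble_weight[OF q \<kappa> XP N])
    also have "\<dots> \<le> (\<Prod>s\<in>?D. 2 * cosh (- ln q * (real_of_int (entry N (\<Phi> X) s) - ?C s)) *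
        (if s \<in> c ` ?U then ?p s else 1))"
    proof (rule prod_mono, intro conjI)
      fix s assume s: "s \<in> ?D"
      show "0 \<le> 2 * cosh (- ln q * (real_of_int (entry N X s) - ?C s))" by simp
      show "2 * cosh (- ln q * (real_of_int (entry N X s) - ?C s)) \<le>
          2 * cosh (- ln q * (real_of_int (entry N (\<Phi> X) s) - ?C s)) * (if s \<in> c ` ?U then ?p s else 1)"
      proof (cases "s \<in> c ` ?U")
        case True
        then show ?thesis unfolding ent[OF X s] using ratio[OF X True] by simp
      next
        case False
        then show ?thesis unfolding ent[OF X s] by simp
      qed
    qed
    also have "\<dots> = norm (ensemble_weight q \<kappa> T S N (\<Phi> X)) * (\<Prod>s\<in>?D. if s \<in> c ` ?U then ?p s else 1)"
      unfolding prod.distrib norm_ensemble_weight[OF q \<kappa> \<Phi>[OF X] N] ..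
    also have "(\<Prod>s\<in>?D. if s \<in> c ` ?U then ?p s else 1) = (\<Prod>s\<in>c ` ?U. ?p s)"
      using prod.inter_restrict[OF finD, of ?p "c ` ?U"] c(2) by (simp add: Int_absorb1)
    also have "\<dots> = (\<sigma>\<^sup>2) ^ (\<Sum>s\<in>?U. d X s)"
      by (simp add: prod.reindex[OF c(1)] power_sum d_def)
    finally show "norm (ensemble_weight q \<kappa> T S N X) \<le>
        norm (ensemble_weight q \<kappa> T S N (\<Phi> X)) * (\<sigma>\<^sup>2) ^ (\<Sum>s\<in>?U. d X s)" .
  qed (use \<sigma> nm E \<Phi> in auto)
qed

section \<open>Comparison of cosh factors\<close>

lemma cosh_mult_le:
  fixes x y :: real
  assumes "0 \<le> x" "0 \<le> y"
  shows "cosh x * cosh y \<le> cosh (x + y)"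
  using assms by (simp add: cosh_add)

text \<open>
  For \<open>y < 0\<close> the point \<open>y\<close> lies beyond the minimum of the potential, and the gain comes only from
  \<open>y + p\<close> being farther from it than \<open>y\<close> by at least \<open>D\<close>.
\<close>

lemma cosh_ratio_le:
  fixes \<theta> \<rho> D y :: real
  assumes \<theta>: "0 < \<theta>" and \<rho>: "0 < \<rho>" "\<rho> < 1" "1 \<le> \<rho> * cosh \<theta>" "2 \<le> exp (\<theta> * D) * \<rho> ^ P"
    and D: "0 \<le> D" "- y \<le> (y + real p) - D" and p: "p \<le> P"
  shows "cosh (\<theta> * y) \<le> cosh (\<theta> * (y + real p)) * \<rho> ^ p"
proof (cases "0 \<le> y")
  case True
  \<comment> \<open>Moving outward from \<open>y \<ge> 0\<close>, each unit step multiplies cosh by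
    at least \<open>cosh \<theta> \<ge> 1 / \<rho>\<close>.\<close>
  show ?thesis
  proof (induction p)
    case (Suc p)
    have "cosh (\<theta> * y) \<le> cosh (\<theta> * (y + real p)) * \<rho> ^ p * 1" using Suc by simp
    also have "\<dots> \<le> cosh (\<theta> * (y + real p)) * \<rho> ^ p * (\<rho> * cosh \<theta>)"
      using \<rho> by (intro mult_left_mono) auto
    also have "\<dots> = (cosh (\<theta> * (y + real p)) * cosh \<theta>) * \<rho> ^ Suc p" by simp
    also have "\<dots> \<le> cosh (\<theta> * (y + real p) + \<theta>) * \<rho> ^ Suc p"
      using True \<theta> \<rho> by (intro mult_right_mono cosh_mult_le) auto
    finally show ?case by (simp add: algebra_simps)
  qed simp
next
  case False
  \<comment> \<open>\<open>w\<close> is the excess of the distance of \<open>y + real p\<close> from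
    0 over that of \<open>y\<close>. As it is at least \<open>D\<close>, the single gain
    \<open>exp (\<theta> * D) / 2\<close> pays for all \<open>p \<le> P\<close> at once.\<close>
  define w where "w = y + real p + y"
  have w: "D \<le> w" using D by (simp add: w_def)
  have "1 \<le> exp (\<theta> * D) / 2 * \<rho> ^ P" using \<rho>(4) by simp
  also have "\<dots> \<le> cosh (\<theta> * w) * \<rho> ^ p"
  proof (intro mult_mono)
    have "exp (\<theta> * D) \<le> exp (\<theta> * w)" using w \<theta> by simp
    then show "exp (\<theta> * D) / 2 \<le> cosh (\<theta> * w)" unfolding cosh_def by (simp add: add_increasing2)
    show "\<rho> ^ P \<le> \<rho> ^ p" using \<rho> p by (intro power_decreasing) auto
  qed (use \<rho> in auto)
  finally have "cosh (\<theta> * y) * 1 \<le> cosh (\<theta> * y) * (cosh (\<theta> * w) * \<rho> ^ p)"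
    by (intro mult_left_mono) auto
  also have "\<dots> = (cosh (\<theta> * - y) * cosh (\<theta> * w)) * \<rho> ^ p" by simp
  also have "\<dots> \<le> cosh (\<theta> * - y + \<theta> * w) * \<rho> ^ p"
    using False \<theta> \<rho> w D(1) by (intro mult_right_mono cosh_mult_le) (auto simp: mult_nonneg_nonpos)
  also have "\<theta> * - y + \<theta> * w = \<theta> * (y + real p)" by (simp add: w_def algebra_simps)
  finally show ?thesis by simp
qed

section \<open>Resetting a rectangle that reaches to a corner of the box\<close>

text \<open>In \<open>E\<close> the entry at \<open>(a, b)\<close> is within
  \<open>N / 2 - D\<close> of the center. The endpoint of \<open>{0..N}\<close> farther from the
  center therefore exceeds the entry's distance from the center by at least \<open>D\<close>, and
  differs from the entry by at least \<open>D\<close>. The rectangle is reset to this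
  endpoint.\<close>

lemma corner_bound:
  fixes q \<sigma> D :: real and \<kappa> :: complex and S T N a b :: int
  defines "z \<equiv> - ln (Im \<kappa>) / ln q"
  defines "E \<equiv> {X \<in> path_ensembles T S N.
    \<bar>real_of_int (entry N X (a, b)) - cell_center z S (a, b)\<bar> \<le> real_of_int N / 2 - D}"
  assumes q: "0 < q" "q < 1" and \<kappa>: "Re \<kappa> = 0" "0 < Im \<kappa>" and N: "0 \<le> N"
    and \<sigma>: "0 < \<sigma>" "\<sigma> < 1" "1 \<le> \<sigma>\<^sup>2 * cosh (- ln q)"
    and D: "0 \<le> D" "2 \<le> exp (- ln q * D) * (\<sigma>\<^sup>2) ^ nat N"
    and ab: "(a, b) \<in> hole_cells T S"
  shows "(\<Sum>X\<in>E. norm (ensemble_weight q \<kappa> T S N X)) \<le>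
    grid_const \<sigma> * \<sigma> ^ nat \<lfloor>D\<rfloor> *
      (\<Sum>X\<in>path_ensembles T S N. norm (ensemble_weight q \<kappa> T S N X))"
proof -
  let ?C = "cell_center z S"
  have a: "1 \<le> a" "a \<le> S" "0 \<le> b" "b \<le> T - S - 1" using ab by (auto simp: hole_cells_def)
  have EP: "E \<subseteq> path_ensembles T S N" by (auto simp: E_def)
  have \<rho>: "0 < \<sigma>\<^sup>2" "\<sigma>\<^sup>2 < 1" using \<sigma> by (auto simp: power_less_one_iff)
  have \<theta>: "0 < - ln q" using q by simp
  note mono = entry_mono[OF subsetD[OF EP] N]
  note eb = entry_bounds(1)[of N] entry_bounds(2)[OF N]
  show ?thesis
  proof (cases "?C (a, b) \<le> real_of_int N / 2")
    \<comment> \<open>\<open>N\<close> is the preferred value. Towards the corner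
      \<open>(S, 0)\<close> entries increase and centers decrease, so \<open>N\<close> stays
      preferred on the whole rectangle.\<close>
    case True
    define c where "c = (\<lambda>(i, j). (a + int i, b - int j))"
    define n where "n = nat (S - a + 1)"
    define m where "m = nat (b + 1)"
    \<comment> \<open>\<open>g (a' + b') < a'\<close> holds exactly for \<open>a \<le> a'\<close>
      and \<open>b' \<le> b\<close>, so the minimum with \<open>g\<close> puts all paths below the
      holes of the rectangle and changes no other entry. Since \<open>g 0 \<ge> 0\<close> and
      \<open>g T \<ge> S\<close>, the endpoints stay fixed.\<close>
    define g where "g t = max (a - 1) (t - b - 1)" for t :: int
    define \<Phi> where "\<Phi> X = (\<lambda>t\<in>{0..T}. \<lambda>i\<in>{1..N}. min (X t i - i + 1) (g t) + i - 1)"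
      for X :: "int \<Rightarrow> int \<Rightarrow> int"
    have cU: "c ` ({..<n} \<times> {..<m}) = {a..S} \<times> {0..b}" (is "?R = _")
    proof
      show "{a..S} \<times> {0..b} \<subseteq> ?R"
      proof
        fix s assume s: "s \<in> {a..S} \<times> {0..b}"
        then have "s = c (nat (fst s - a), nat (b - snd s))" by (auto simp: c_def)
        moreover have "(nat (fst s - a), nat (b - snd s)) \<in> {..<n} \<times> {..<m}"
          using s by (auto simp: n_def m_def)
        ultimately show "s \<in> ?R" by blast
      qed
    qed (auto simp: c_def n_def m_def)
    have \<Phi>: "\<Phi> X \<in> path_ensembles T S N" if "X \<in> E" for X
      unfolding \<Phi>_def
      by (rule path_ensemble_modify) (use that EP a in \<open>auto simp: g_def\<close>)
    have lo: "entry N X (a, b) \<le> entry N X s" if "X \<in> E" "s \<in> ?R" for X s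
      using mono[OF that(1) ab, of "fst s" "snd s"] that(2) a unfolding cU
      by (auto simp: hole_cells_def)
    show ?thesis
      unfolding z_def
    proof (rule rectangle_bound[OF q \<kappa> N _ \<sigma>(1,2), where e = N and c = c and n = n and m = m and \<Phi> = \<Phi>])
      show "inj_on c ({..<n} \<times> {..<m})" by (auto simp: inj_on_def c_def)
      show "?R \<subseteq> hole_cells T S" unfolding cU using a by (auto simp: hole_cells_def)
      show "entry N (\<Phi> X) s = (if s \<in> ?R then N else entry N X s)"
        if X: "X \<in> E" and s: "s \<in> hole_cells T S" for X s
      proof -
        obtain a' b' where s': "s = (a', b')" by fastforce
        note t = cell_time[OF s[unfolded s']]
        have "entry N (\<Phi> X) (a', b') = (if s \<in> ?R then N else entry N X s)"
        proof (rule entry_unique[OF \<Phi>[OF X] t])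
          show "(if s \<in> ?R then N else entry N X s) \<in> {0..N}" using N eb by simp
          fix i assume i: "i \<in> {1..N}"
          show "i \<le> (if s \<in> ?R then N else entry N X s) \<longleftrightarrow> \<Phi> X (a' + b') i - i + 1 < a'"
            using le_entry_iff[OF subsetD[OF EP X] t i] i t s a unfolding cU s'
            by (auto simp: \<Phi>_def g_def hole_cells_def)
        qed
        then show ?thesis by (simp add: s')
      qed
      show "\<bar>N - entry N X (c (i', j'))\<bar> \<le> \<bar>N - entry N X (c (i, j))\<bar>"
        if "X \<in> E" "i \<le> i'" "i' < n" "j \<le> j'" "j' < m" for X i i' j j'
      proof -
        have "entry N X (c (i, j)) \<le> entry N X (c (i', j'))"
          unfolding c_def prod.case using that a
          by (intro mono) (auto simp: hole_cells_def n_def m_def)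
        then show ?thesis using eb(2)[of X "c (i', j')"] by simp
      qed
      show "nat \<lfloor>D\<rfloor> \<le> nat \<bar>N - entry N X (c (0, 0))\<bar>" if "X \<in> E" for X
      proof -
        have "D \<le> real_of_int (N - entry N X (a, b))" using that True by (auto simp: E_def)
        then have "\<lfloor>D\<rfloor> \<le> N - entry N X (a, b)" by (simp add: floor_le_iff)
        then show ?thesis by (auto simp: c_def intro!: nat_mono)
      qed
      show "cosh (- ln q * (real_of_int (entry N X s) - cell_center (- ln (Im \<kappa>) / ln q) S s)) \<le>
          cosh (- ln q * (real_of_int N - cell_center (- ln (Im \<kappa>) / ln q) S s)) *
            (\<sigma>\<^sup>2) ^ nat \<bar>N - entry N X s\<bar>"
        if X: "X \<in> E" and s: "s \<in> ?R" for X s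
      proof -
        define p where "p = nat (N - entry N X s)"
        define y where "y = real_of_int (entry N X s) - ?C s"
        have p: "real p = real_of_int N - real_of_int (entry N X s)" "nat \<bar>N - entry N X s\<bar> = p" "p \<le> nat N"
          using eb[of X s] by (auto simp: p_def)
        have "?C s \<le> ?C (a, b)" using s unfolding cU by (auto simp: cell_center_def)
        moreover have "real_of_int (entry N X (a, b)) \<le> real_of_int (entry N X s)" using lo[OF X s] by simp
        moreover have "?C (a, b) - real_of_int (entry N X (a, b)) \<le> real_of_int N / 2 - D"
          using X unfolding E_def by auto
        ultimately have "- y \<le> (y + real p) - D" using True p(1) unfolding y_def by linarith
        from cosh_ratio_le[OF \<theta> \<rho> \<sigma>(3) D(2,1) this p(3)]
        have le: "cosh (- ln q * y) \<le> cosh (- ln q * (y + real p)) * (\<sigma>\<^sup>2) ^ p" .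
        have "y + real p = real_of_int N - ?C s" using p(1) by (simp add: y_def)
        then show ?thesis using le unfolding p(2) z_def[symmetric] by (simp only: y_def)
      qed
    qed (use a EP \<Phi> in \<open>auto simp: n_def m_def\<close>)
  next
    \<comment> \<open>Here 0 is preferred, and the rectangle reaches to the opposite corner
      \<open>(1, T - S - 1)\<close>, towards which entries decrease and centers increase.\<close>
    case False
    define c where "c = (\<lambda>(i, j). (a - int i, b + int j))"
    define n where "n = nat a"
    define m where "m = nat (T - S - b)"
    \<comment> \<open>\<open>g (a' + b') \<ge> a'\<close> holds exactly for
      \<open>a' \<le> a\<close> and \<open>b \<le> b'\<close>, so the maximum with \<open>g\<close>
      lifts all paths above the holes of the rectangle and changes no other entry.\<close>
    define g where "g t = min a (t - b)" for t :: int
    define \<Phi> where "\<Phi> X = (\<lambda>t\<in>{0..T}. \<lambda>i\<in>{1..N}. max (X t i - i + 1) (g t) + i - 1)"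
      for X :: "int \<Rightarrow> int \<Rightarrow> int"
    have cU: "c ` ({..<n} \<times> {..<m}) = {1..a} \<times> {b..T - S - 1}" (is "?R = _")
    proof
      show "{1..a} \<times> {b..T - S - 1} \<subseteq> ?R"
      proof
        fix s assume s: "s \<in> {1..a} \<times> {b..T - S - 1}"
        then have "s = c (nat (a - fst s), nat (snd s - b))" by (auto simp: c_def)
        moreover have "(nat (a - fst s), nat (snd s - b)) \<in> {..<n} \<times> {..<m}"
          using s by (auto simp: n_def m_def)
        ultimately show "s \<in> ?R" by blast
      qed
    qed (auto simp: c_def n_def m_def)
    have \<Phi>: "\<Phi> X \<in> path_ensembles T S N" if "X \<in> E" for X
      unfolding \<Phi>_def
      by (rule path_ensemble_modify) (use that EP a in \<open>auto simp: g_def\<close>)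
    have hi: "entry N X s \<le> entry N X (a, b)" if "X \<in> E" "s \<in> ?R" for X s
      using mono[OF that(1) _ ab, of "fst s" "snd s"] that(2) a unfolding cU
      by (auto simp: hole_cells_def)
    show ?thesis
      unfolding z_def
    proof (rule rectangle_bound[OF q \<kappa> N _ \<sigma>(1,2), where e = 0 and c = c and n = n and m = m and \<Phi> = \<Phi>])
      show "inj_on c ({..<n} \<times> {..<m})" by (auto simp: inj_on_def c_def)
      show "?R \<subseteq> hole_cells T S" unfolding cU using a by (auto simp: hole_cells_def)
      show "entry N (\<Phi> X) s = (if s \<in> ?R then 0 else entry N X s)"
        if X: "X \<in> E" and s: "s \<in> hole_cells T S" for X s
      proof -
        obtain a' b' where s': "s = (a', b')" by fastforce
        note t = cell_time[OF s[unfolded s']]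
        have "entry N (\<Phi> X) (a', b') = (if s \<in> ?R then 0 else entry N X s)"
        proof (rule entry_unique[OF \<Phi>[OF X] t])
          show "(if s \<in> ?R then 0 else entry N X s) \<in> {0..N}" using N eb by simp
          fix i assume i: "i \<in> {1..N}"
          show "i \<le> (if s \<in> ?R then 0 else entry N X s) \<longleftrightarrow> \<Phi> X (a' + b') i - i + 1 < a'"
            using le_entry_iff[OF subsetD[OF EP X] t i] i t s a unfolding cU s'
            by (auto simp: \<Phi>_def g_def hole_cells_def)
        qed
        then show ?thesis by (simp add: s')
      qed
      show "\<bar>0 - entry N X (c (i', j'))\<bar> \<le> \<bar>0 - entry N X (c (i, j))\<bar>"
        if "X \<in> E" "i \<le> i'" "i' < n" "j \<le> j'" "j' < m" for X i i' j j'
      proof -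
        have "entry N X (c (i', j')) \<le> entry N X (c (i, j))"
          unfolding c_def prod.case using that a
          by (intro mono) (auto simp: hole_cells_def n_def m_def)
        then show ?thesis using eb(1)[of X "c (i', j')"] by simp
      qed
      show "nat \<lfloor>D\<rfloor> \<le> nat \<bar>0 - entry N X (c (0, 0))\<bar>" if "X \<in> E" for X
      proof -
        have "D \<le> real_of_int (entry N X (a, b))" using that False by (auto simp: E_def)
        then have "\<lfloor>D\<rfloor> \<le> entry N X (a, b)" by (simp add: floor_le_iff)
        then show ?thesis by (auto simp: c_def intro!: nat_mono)
      qed
      show "cosh (- ln q * (real_of_int (entry N X s) - cell_center (- ln (Im \<kappa>) / ln q) S s)) \<le>
          cosh (- ln q * (real_of_int 0 - cell_center (- ln (Im \<kappa>) / ln q) S s)) *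
            (\<sigma>\<^sup>2) ^ nat \<bar>0 - entry N X s\<bar>"
        if X: "X \<in> E" and s: "s \<in> ?R" for X s
      proof -
        define p where "p = nat (entry N X s)"
        \<comment> \<open>The sign is opposite to the other case, because the move outward now goes
          down to 0; cosh is even.\<close>
        define y where "y = ?C s - real_of_int (entry N X s)"
        have p: "real p = real_of_int (entry N X s)" "nat \<bar>0 - entry N X s\<bar> = p" "p \<le> nat N"
          using eb[of X s] by (auto simp: p_def)
        have "?C (a, b) \<le> ?C s" using s unfolding cU by (auto simp: cell_center_def)
        moreover have "real_of_int (entry N X s) \<le> real_of_int (entry N X (a, b))" using hi[OF X s] by simp
        moreover have "real_of_int (entry N X (a, b)) - ?C (a, b) \<le> real_of_int N / 2 - D"
          using X unfolding E_def by auto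
        ultimately have "- y \<le> (y + real p) - D" using False p(1) unfolding y_def by linarith
        from cosh_ratio_le[OF \<theta> \<rho> \<sigma>(3) D(2,1) this p(3)]
        have le: "cosh (- ln q * y) \<le> cosh (- ln q * (y + real p)) * (\<sigma>\<^sup>2) ^ p" .
        have "- ln q * (real_of_int (entry N X s) - ?C s) = - (- ln q * y)"
          "- ln q * (real_of_int 0 - ?C s) = - (- ln q * (y + real p))"
          using p(1) by (simp_all add: y_def algebra_simps)
        then show ?thesis using le unfolding p(2) z_def[symmetric] by (simp only: cosh_minus)
      qed
    qed (use a EP \<Phi> in \<open>auto simp: n_def m_def\<close>)
  qed
qed

text \<open>Union bound: a hole at time \<open>t\<close> belongs to a cell with
  \<open>a + b = t\<close>, and there are at most \<open>S\<close> such cells. The hypothesis on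
  \<open>B\<close> says that the entry is within \<open>N / 2 - D\<close> of the center, written in
  the height \<open>y\<close> of the hole.\<close>

lemma prob_hole_le:
  fixes q \<sigma> D r :: real and \<kappa> :: complex and S T N t :: int
  defines "z \<equiv> - ln (Im \<kappa>) / ln q"
  assumes q: "0 < q" "q < 1" and \<kappa>: "Re \<kappa> = 0" "0 < Im \<kappa>" and ST: "0 < S" "S < T" and N: "0 \<le> N"
    and \<sigma>: "0 < \<sigma>" "\<sigma> < 1" "1 \<le> \<sigma>\<^sup>2 * cosh (- ln q)"
    and D: "0 \<le> D" "2 \<le> exp (- ln q * D) * (\<sigma>\<^sup>2) ^ nat N"
    and B: "\<And>X y. B X y \<Longrightarrow> \<bar>real_of_int y - (real_of_int t + real_of_int S) / 2 + 1 / 2 - z\<bar> \<le> real_of_int N / 2 - D"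
  shows "\<P>(X in qRacah_measure q \<kappa> T S N. \<exists>y. (t, y) \<in> holes T S N X \<and> B X y)
    \<le> real_of_int S * (grid_const \<sigma> * \<sigma> ^ nat \<lfloor>D\<rfloor>)"
proof -
  let ?P = "path_ensembles T S N" and ?W = "\<lambda>X. norm (ensemble_weight q \<kappa> T S N X)"
  let ?E = "\<lambda>s. {X \<in> ?P. \<bar>real_of_int (entry N X s) - cell_center z S s\<bar> \<le> real_of_int N / 2 - D}"
  define F where "F = {X \<in> space (qRacah_measure q \<kappa> T S N). \<exists>y. (t, y) \<in> holes T S N X \<and> B X y}"
  define A where "A = (\<lambda>a. (a, t - a)) ` {1..S} \<inter> hole_cells T S"
  have finA: "finite A" by (simp add: A_def)
  have "card A \<le> card ((\<lambda>a. (a, t - a)) ` {1..S})" by (intro card_mono) (auto simp: A_def)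
  also have "\<dots> \<le> card {1..S}" by (intro card_image_le) simp
  finally have "int (card A) \<le> S" using ST by simp
  then have cardA: "real (card A) \<le> real_of_int S" by linarith
  have FP: "F \<subseteq> ?P" by (auto simp: F_def qRacah_measure_def space_point_measure)
  have "F \<subseteq> (\<Union>s\<in>A. ?E s)"
  proof
    fix X assume X: "X \<in> F"
    then obtain y where y: "(t, y) \<in> holes T S N X" "B X y" by (auto simp: F_def)
    have XP: "X \<in> ?P" using X FP by blast
    obtain s where s: "s \<in> hole_cells T S" "(\<lambda>(a, b). (a + b, entry N X (a, b) + a - 1)) s = (t, y)"
      using holes_bij_betw[OF XP N] y(1) unfolding bij_betw_def by (metis (no_types, lifting) imageE)
    obtain a b where ab: "s = (a, b)" by fastforce
    have ty: "t = a + b" "y = entry N X (a, b) + a - 1" using s(2) by (auto simp: ab)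
    have "s \<in> A" using s(1) by (auto simp: A_def ab ty hole_cells_def)
    moreover have "real_of_int y - (real_of_int t + real_of_int S) / 2 + 1 / 2 - z =
        real_of_int (entry N X s) - cell_center z S s"
      by (simp add: ty ab cell_center_def field_simps)
    then have "X \<in> ?E s" using B[OF y(2)] XP by simp
    ultimately show "X \<in> (\<Union>s\<in>A. ?E s)" by blast
  qed
  then have "(\<Sum>X\<in>F. ?W X) \<le> (\<Sum>X\<in>(\<Union>s\<in>A. ?E s). ?W X)"
    using finA finite_path_ensembles by (intro sum_mono2) auto
  \<comment> \<open>The disjoint union counts an ensemble once per cell, which bounds the sum over
    the union by a double sum.\<close>
  also have "(\<Union>s\<in>A. ?E s) = snd ` Sigma A ?E" by force
  also have "(\<Sum>X\<in>snd ` Sigma A ?E. ?W X) \<le> (\<Sum>p\<in>Sigma A ?E. (?W \<circ> snd) p)"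
    using finA finite_path_ensembles by (intro sum_image_le finite_SigmaI) auto
  also have "\<dots> = (\<Sum>s\<in>A. \<Sum>X\<in>?E s. ?W X)"
    using finA finite_path_ensembles by (subst sum.Sigma) (auto simp: case_prod_beta)
  also have "\<dots> \<le> (\<Sum>s\<in>A. grid_const \<sigma> * \<sigma> ^ nat \<lfloor>D\<rfloor> * (\<Sum>X\<in>?P. ?W X))"
  proof (rule sum_mono)
    fix s assume s: "s \<in> A"
    obtain a b where ab: "s = (a, b)" by fastforce
    show "(\<Sum>X\<in>?E s. ?W X) \<le> grid_const \<sigma> * \<sigma> ^ nat \<lfloor>D\<rfloor> * (\<Sum>X\<in>?P. ?W X)"
      using corner_bound[OF q \<kappa> N \<sigma> D, of a b T S] s unfolding ab z_def by (simp add: A_def)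
  qed
  also have "\<dots> = real (card A) * (grid_const \<sigma> * \<sigma> ^ nat \<lfloor>D\<rfloor>) * (\<Sum>X\<in>?P. ?W X)" by simp
  also have "\<dots> \<le> real_of_int S * (grid_const \<sigma> * \<sigma> ^ nat \<lfloor>D\<rfloor>) * (\<Sum>X\<in>?P. ?W X)"
    using cardA \<sigma> by (intro mult_right_mono sum_nonneg) (auto simp: grid_const_def)
  finally have le: "(\<Sum>X\<in>F. ?W X) \<le> real_of_int S * (grid_const \<sigma> * \<sigma> ^ nat \<lfloor>D\<rfloor>) * (\<Sum>X\<in>?P. ?W X)" .
  have nn: "0 \<le> real_of_int S * (grid_const \<sigma> * \<sigma> ^ nat \<lfloor>D\<rfloor>)" using ST \<sigma> by (simp add: grid_const_def)
  have "measure (qRacah_measure q \<kappa> T S N) F = (\<Sum>X\<in>F. ?W X) / (\<Sum>X\<in>?P. ?W X)"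
    by (rule measure_qRacah[OF q(1) \<kappa> ST FP])
  also have "\<dots> \<le> real_of_int S * (grid_const \<sigma> * \<sigma> ^ nat \<lfloor>D\<rfloor>)"
  \<comment> \<open>A vanishing denominator would make the quotient 0, and the right-hand side is
    nonnegative.\<close>
  proof (cases "(\<Sum>X\<in>?P. ?W X) = 0")
    case False
    moreover have "0 \<le> (\<Sum>X\<in>?P. ?W X)" by (intro sum_nonneg) simp
    ultimately show ?thesis using le by (simp add: divide_le_eq)
  qed (use nn in simp)
  finally show ?thesis unfolding F_def .
qed

section \<open>Scaling and choice of constants\<close>

theorem theorem5p11:
  fixes q :: real and \<kappa> :: complex and T' S' N' t' \<epsilon> :: real
  assumes "0 < q" "q < 1"
    and "Re \<kappa> = 0" "0 < Im \<kappa>"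
    and "0 < S'" "S' < T'" "0 < N'"
    and "0 < \<epsilon>"
  shows "\<exists>c>0. \<forall>\<^sub>F L :: real in at_top.
    (let T = \<lfloor>L * T'\<rfloor>; S = \<lfloor>L * S'\<rfloor>; N = \<lfloor>L * N'\<rfloor>; t = \<lfloor>L * t'\<rfloor>;
         t_l = \<bar>N' - S'\<bar>; t_r = min (N' + S') (2 * T' - N' - S')
     in \<P>(X in qRacah_measure q \<kappa> T S N.
          \<exists>y. (t, y) \<in> holes T S N X \<and>
              t_l + \<epsilon> < real_of_int t / L \<and> real_of_int t / L < t_r - \<epsilon> \<and>
              \<bar>real_of_int y / L - (S' + t') / 2\<bar> < (N' - \<epsilon>) / 2)
        < exp (- c * L))"
proof -
  note q = assms(1,2) and \<kappa> = assms(3,4)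
  define \<theta> where "\<theta> = - ln q"
  \<comment> \<open>The condition on \<open>y\<close> leaves a margin
    \<open>\<epsilon> * L / 2 = 2 * \<delta> * L\<close> below \<open>L * N' / 2\<close>; half of it
    becomes \<open>D = \<delta> * L\<close>, the other half absorbs rounding errors and
    \<open>z\<close>.\<close>
  define \<delta> where "\<delta> = \<epsilon> / 4"
  define z where "z = - ln (Im \<kappa>) / ln q"
  \<comment> \<open>The first term gives \<open>1 \<le> \<rho> * cosh \<theta>\<close>. The second
    keeps \<open>\<rho> ^ nat N\<close> above \<open>exp (- (\<theta> * \<delta> * L / 2))\<close>,
    so that half of the exponent of \<open>exp (\<theta> * D)\<close> survives. Neither depends on
    \<open>L\<close>.\<close>
  define \<rho> where "\<rho> = max (1 / cosh \<theta>) (exp (- (\<theta> * \<delta> / (2 * N'))))"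
  define \<sigma> where "\<sigma> = sqrt \<rho>"
  have \<theta>: "0 < \<theta>" and \<delta>: "0 < \<delta>" using q assms(8) by (auto simp: \<theta>_def \<delta>_def)
  have "1 < cosh \<theta>" using \<theta> cosh_real_strict_mono[of 0 \<theta>] by simp
  then have \<rho>: "0 < \<rho>" "\<rho> < 1" "1 \<le> \<rho> * cosh \<theta>"
    using \<theta> \<delta> assms(7) by (auto simp: \<rho>_def less_max_iff_disj max_mult_distrib_right le_max_iff_disj)
  have \<sigma>2: "\<sigma>\<^sup>2 = \<rho>" using \<rho> by (simp add: \<sigma>_def)
  have \<sigma>: "0 < \<sigma>" "\<sigma> < 1" using \<rho> by (auto simp: \<sigma>_def)
  define \<gamma> where "\<gamma> = - (\<delta> * ln \<sigma>)"
  have \<gamma>: "0 < \<gamma>" using \<sigma> \<delta> by (simp add: \<gamma>_def mult_pos_neg)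
  \<comment> \<open>The factor \<open>S'\<close> comes from the union bound and
    \<open>1 / \<sigma>\<close> from rounding \<open>D\<close> down.\<close>
  define K where "K = S' * grid_const \<sigma> / \<sigma>"
  have K: "0 < K" using \<sigma> assms(5) by (simp add: K_def grid_const_def)
  have pos: "\<forall>\<^sub>F L :: real in at_top. 1 \<le> L * S' \<and> 1 \<le> L * (T' - S') \<and> 0 < L
      \<and> 2 \<le> exp (\<theta> * \<delta> * L / 2) \<and> L * K * exp (- (\<gamma> * L)) < exp (- (\<gamma> / 2) * L)
      \<and> 2 + \<bar>z\<bar> \<le> L * \<delta>"
  proof -
    define \<tau> where "\<tau> = T' - S'"
    have \<tau>: "0 < \<tau>" using assms(6) by (simp add: \<tau>_def)
    show ?thesis
      unfolding \<tau>_def[symmetric]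
    proof (intro eventually_conj)
      show "\<forall>\<^sub>F L in at_top. 1 \<le> L * S'" using assms(5) by real_asymp
      show "\<forall>\<^sub>F L in at_top. 1 \<le> L * \<tau>" using \<tau> by real_asymp
      show "\<forall>\<^sub>F L :: real in at_top. 0 < L" by real_asymp
      show "\<forall>\<^sub>F L in at_top. 2 \<le> exp (\<theta> * \<delta> * L / 2)" using \<theta> \<delta> by real_asymp
      show "\<forall>\<^sub>F L in at_top. L * K * exp (- (\<gamma> * L)) < exp (- (\<gamma> / 2) * L)" using K \<gamma> by real_asymp
      show "\<forall>\<^sub>F L in at_top. 2 + \<bar>z\<bar> \<le> L * \<delta>" using \<delta> by real_asymp
    qed
  qed
  show ?thesis
  \<comment> \<open>Half of the rate \<open>\<gamma>\<close> is given up to absorb the linear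
    prefactor \<open>L * K\<close>.\<close>
  proof (intro exI[of _ "\<gamma> / 2"] conjI)
    show "0 < \<gamma> / 2" using \<gamma> by simp
    show "\<forall>\<^sub>F L :: real in at_top.
      (let T = \<lfloor>L * T'\<rfloor>; S = \<lfloor>L * S'\<rfloor>; N = \<lfloor>L * N'\<rfloor>; t = \<lfloor>L * t'\<rfloor>;
           t_l = \<bar>N' - S'\<bar>; t_r = min (N' + S') (2 * T' - N' - S')
       in \<P>(X in qRacah_measure q \<kappa> T S N.
            \<exists>y. (t, y) \<in> holes T S N X \<and>
                t_l + \<epsilon> < real_of_int t / L \<and> real_of_int t / L < t_r - \<epsilon> \<and>
                \<bar>real_of_int y / L - (S' + t') / 2\<bar> < (N' - \<epsilon>) / 2)
          < exp (- (\<gamma> / 2) * L))"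
      using pos
    proof eventually_elim
      case (elim L)
      let ?T = "\<lfloor>L * T'\<rfloor>" and ?S = "\<lfloor>L * S'\<rfloor>" and ?N = "\<lfloor>L * N'\<rfloor>" and ?t = "\<lfloor>L * t'\<rfloor>"
      define D where "D = \<delta> * L"
      have L: "0 < L" using elim by simp
      have "?S < ?T" using elim by (simp add: algebra_simps) linarith
      moreover have "0 < ?S" using elim by simp
      moreover have N: "0 \<le> ?N" using L assms(7) by simp
      moreover have "0 \<le> D" using L \<delta> by (simp add: D_def)
      moreover have "2 \<le> exp (\<theta> * D) * (\<sigma>\<^sup>2) ^ nat ?N"
      proof -
        have "real (nat ?N) \<le> L * N'" using N by simp
        then have "\<theta> * \<delta> / (2 * N') * real (nat ?N) \<le> \<theta> * \<delta> / (2 * N') * (L * N')"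
          using \<theta> \<delta> assms(7) by (intro mult_left_mono) auto
        then have "- (\<theta> * \<delta> * L / 2) \<le> real (nat ?N) * - (\<theta> * \<delta> / (2 * N'))"
          using assms(7) by (simp add: field_simps)
        then have "exp (- (\<theta> * \<delta> * L / 2)) \<le> exp (- (\<theta> * \<delta> / (2 * N'))) ^ nat ?N"
          by (simp only: exp_of_nat_mult[symmetric] exp_le_cancel_iff)
        also have "\<dots> \<le> \<rho> ^ nat ?N" by (intro power_mono) (auto simp: \<rho>_def)
        finally have "exp (\<theta> * D) * exp (- (\<theta> * \<delta> * L / 2)) \<le> exp (\<theta> * D) * \<rho> ^ nat ?N"
          by simp
        moreover have "exp (\<theta> * D) * exp (- (\<theta> * \<delta> * L / 2)) = exp (\<theta> * \<delta> * L / 2)"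
          by (simp add: D_def exp_add[symmetric])
        ultimately show ?thesis using elim by (simp add: \<sigma>2)
      qed
      moreover have "\<bar>real_of_int y - (real_of_int ?t + real_of_int ?S) / 2 + 1 / 2 - z\<bar>
          \<le> real_of_int ?N / 2 - D"
        if "\<bar>real_of_int y / L - (S' + t') / 2\<bar> < (N' - \<epsilon>) / 2" for y
      proof -
        have "\<bar>real_of_int y / L - (S' + t') / 2\<bar> * L < (N' - \<epsilon>) / 2 * L"
          using that L by simp
        moreover have "\<bar>real_of_int y / L - (S' + t') / 2\<bar> * L = \<bar>real_of_int y - (L * S' + L * t') / 2\<bar>"
          using L by (simp add: abs_mult_pos' field_simps flip: abs_mult_pos)
        ultimately have "\<bar>real_of_int y - (L * S' + L * t') / 2\<bar> < L * N' / 2 - 2 * D"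
          by (simp add: D_def \<delta>_def algebra_simps)
        moreover have "2 + \<bar>z\<bar> \<le> D" using elim by (simp add: D_def mult.commute)
        \<comment> \<open>Rounding costs at most 1/2 each for \<open>S\<close>, \<open>t\<close> and
          \<open>N\<close>; with the shift 1/2 the errors add up to at most 2, hence the requirement
          \<open>2 + \<bar>z\<bar> \<le> D\<close>.\<close>
        moreover have "real_of_int ?S \<le> L * S'" "L * S' \<le> real_of_int ?S + 1" "real_of_int ?t \<le> L * t'"
          "L * t' \<le> real_of_int ?t + 1" "L * N' \<le> real_of_int ?N + 1" "z \<le> \<bar>z\<bar>" "- z \<le> \<bar>z\<bar>"
          by linarith+
        ultimately show ?thesis unfolding abs_less_iff by (intro abs_leI) argo+
      qed
      ultimately have "\<P>(X in qRacah_measure q \<kappa> ?T ?S ?N. \<exists>y. (?t, y) \<in> holes ?T ?S ?N X \<and>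
            (\<bar>N' - S'\<bar> + \<epsilon> < real_of_int ?t / L \<and> real_of_int ?t / L < min (N' + S') (2 * T' - N' - S') - \<epsilon> \<and>
              \<bar>real_of_int y / L - (S' + t') / 2\<bar> < (N' - \<epsilon>) / 2))
          \<le> real_of_int ?S * (grid_const \<sigma> * \<sigma> ^ nat \<lfloor>D\<rfloor>)"
        using \<sigma> \<rho>(3) by (intro prob_hole_le[OF q \<kappa>]) (auto simp: \<sigma>2 \<theta>_def z_def)
      also have "\<dots> \<le> (L * S') * (grid_const \<sigma> * (exp (- (\<gamma> * L)) / \<sigma>))"
      proof (intro mult_mono)
        show "real_of_int ?S \<le> L * S'" by linarith
        have "D - 1 \<le> real (nat \<lfloor>D\<rfloor>)" using L \<delta> by (simp add: D_def)
        then have "real (nat \<lfloor>D\<rfloor>) * ln \<sigma> \<le> (D - 1) * ln \<sigma>" using \<sigma> by (intro mult_right_mono_neg) auto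
        then have "exp (real (nat \<lfloor>D\<rfloor>) * ln \<sigma>) \<le> exp ((D - 1) * ln \<sigma>)" by simp
        also have "exp (real (nat \<lfloor>D\<rfloor>) * ln \<sigma>) = \<sigma> ^ nat \<lfloor>D\<rfloor>" using \<sigma> by (simp add: exp_of_nat_mult)
        also have "(D - 1) * ln \<sigma> = - (\<gamma> * L) - ln \<sigma>" by (simp add: D_def \<gamma>_def algebra_simps)
        also have "exp (- (\<gamma> * L) - ln \<sigma>) = exp (- (\<gamma> * L)) / \<sigma>" using \<sigma> by (simp add: exp_diff)
        finally show "\<sigma> ^ nat \<lfloor>D\<rfloor> \<le> exp (- (\<gamma> * L)) / \<sigma>" .
      qed (use \<sigma> L assms(5) in \<open>auto simp: grid_const_def\<close>)
      also have "\<dots> = L * K * exp (- (\<gamma> * L))" by (simp add: K_def)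
      also have "\<dots> < exp (- (\<gamma> / 2) * L)" using elim by blast
      finally show ?case unfolding Let_def .
    qed
  qed
qed

end
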